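(* Let $\gamma\in(0,1)$, let $n\ge2$ be an integer, let $0\le\kappa<\Lambda_{n,\gamma}$, fix an integer $m\ge0$, and let $\sigma_j,\tau_j$, $\mathcal G_m$ and the constants $c_j$ ($j\ge0$) be as in the context. Let $h:\mathbb R\to\mathbb R$ satisfy $h(t)=O(e^{-\delta t})$ as $t\to+\infty$ and $h(t)=O(e^{\delta_0t})$ as $t\to-\infty$ for some real $\delta,\delta_0>-\sigma_0$, and let $w(t)=\int_{\mathbb R}\mathcal G_m(t-t')h(t')\,dt'$ (a particular solution of $P_\gamma^{(m)}w-\kappa w=h$). Define the complex-valued functions $w_j:\mathbb R\to\mathbb C$ by $$w_j(t)=\int_{\mathbb R}e^{-(\sigma_j+i\tau_j)|t-t'|}h(t')\,dt'.$$ Then they satisfy the second order ODE $$-\frac{1}{\sigma_j+i\tau_j}w_j''+(\sigma_j+i\tau_j)w_j=2h,$$ and the original (real-valued) function $w$ can still be recovered by $$w(t)=\mathrm{Re}\sum_{j=0}^\infty c_jw_j(t).$$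
   Context: $\Lambda_{n,\gamma}=2^{2\gamma}\big(\Gamma(\tfrac{n+2\gamma}{4})/\Gamma(\tfrac{n-2\gamma}{4})\big)^2$. Let $\mu_m$, $m=0,1,\dots$, be the eigenvalues of the (positive) Laplacian on $\mathbb S^{n-1}$ repeated with multiplicity, and $A_m=\frac12+\frac\gamma2+\frac12\sqrt{(\frac n2-1)^2+\mu_m}$, $B_m=\frac12-\frac\gamma2+\frac12\sqrt{(\frac n2-1)^2+\mu_m}$. $P_\gamma^{(m)}$ is the projection onto the $m$-th spherical harmonic of the conformal fractional Laplacian $P_\gamma w=r^{\frac{n+2\gamma}{2}}(-\Delta_{\mathbb R^n})^\gamma(r^{-\frac{n-2\gamma}{2}}w)$, $r=e^{-t}$, on the cylinder $\mathbb R\times\mathbb S^{n-1}$; it is the Fourier multiplier on $\mathbb R$ with symbol $$\Theta_m(\xi)=2^{2\gamma}\frac{\Gamma(A_m+\frac{\xi i}{2})\Gamma(A_m-\frac{\xi i}2)}{\Gamma(B_m+\frac{\xi i}2)\Gamma(B_m-\frac{\xi i}2)},$$ extended meromorphically to $\mathbb C$. The poles of $1/(\Theta_m(z)-\kappa)$ are at $\pm\tau_j\pm i\sigma_j$, $j\ge0$, with $\tau_0=0$, $\tau_j\ge0$, $\tau_j=0$ for all large $j$, $\sigma_j>\sigma_0>0$ for $j\ge1$. It is known that, for $h$ with the stated decay, $w=\mathcal G_m*h$ solves $P_\gamma^{(m)}w-\kappa w=h$, where $$\mathcal G_m(t)=c_0e^{-\sigma_0|t|}+\sum_{j=1}^\infty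 e^{-\sigma_j|t|}\big[c_j\cos(\tau_j|t|)+c_j'\sin(\tau_j|t|)\big]$$ for some precise real constants $c_j,c_j'$ depending on $\kappa,n,\gamma$. The $c_j$ in the claim are the constants denoted $c_j$ in this formula. *)

theory Defs
  imports
    "HOL-Complex_Analysis.Complex_Analysis"
    "HOL-Library.Function_Algebras"
    "HOL-Library.Landau_Symbols"
begin

definition Lambda_const :: "nat \<Rightarrow> real \<Rightarrow> real" where
  "Lambda_const n \<gamma> =
     2 powr (2 * \<gamma>) * (Gamma ((real n + 2 * \<gamma>) / 4) / Gamma ((real n - 2 * \<gamma>) / 4))\<^sup>2"

definition C2_on :: "('a::euclidean_space \<Rightarrow> real) \<Rightarrow> 'a set \<Rightarrow> bool" where
  "C2_on F U \<longleftrightarrow>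
     (\<exists>(F' :: 'a \<Rightarrow> 'a \<Rightarrow>\<^sub>L real) (F'' :: 'a \<Rightarrow> 'a \<Rightarrow>\<^sub>L ('a \<Rightarrow>\<^sub>L real)).
        (\<forall>x\<in>U. (F has_derivative blinfun_apply (F' x)) (at x)) \<and>
        (\<forall>x\<in>U. (F' has_derivative blinfun_apply (F'' x)) (at x)) \<and>
        continuous_on U F'')"

definition laplacian :: "('a::euclidean_space \<Rightarrow> real) \<Rightarrow> 'a \<Rightarrow> real" where
  "laplacian F x = (\<Sum>b\<in>Basis. deriv (deriv (\<lambda>s. F (x + s *\<^sub>R b))) 0)"

text \<open>The Laplace--Beltrami operator of the unit sphere, acting on \<open>f\<close>, is the restriction to the
  sphere of the Euclidean Laplacian of the extension of \<open>f\<close> that is homogeneous of degree 0.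
  Functions on the sphere are represented by functions on the ambient space that vanish off the
  sphere, so that the dimension of an eigenspace below is that of a space of functions
  on the sphere.\<close>

definition radial_ext :: "('a::euclidean_space \<Rightarrow> real) \<Rightarrow> 'a \<Rightarrow> real" where
  "radial_ext f x = f (x /\<^sub>R norm x)"

definition sphere_eigenspace :: "real \<Rightarrow> ('a::euclidean_space \<Rightarrow> real) set" where
  "sphere_eigenspace l =
     {f. (\<forall>x. x \<notin> sphere 0 1 \<longrightarrow> f x = 0) \<and>
         C2_on (radial_ext f) (- {0}) \<and>
         (\<forall>x\<in>sphere 0 1. - laplacian (radial_ext f) x = l * f x)}"

text \<open>\<open>\<mu>\<close> lists the eigenvalues of the positive Laplacian on the unit sphere of \<open>'a\<close> in
  nondecreasing order, each repeated according to its multiplicity. The finiteness clause is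
  needed because both \<open>card\<close> and \<open>dim\<close> are 0 in the infinite case.\<close>

definition sphere_eigenvalues :: "'a::euclidean_space itself \<Rightarrow> (nat \<Rightarrow> real) \<Rightarrow> bool" where
  "sphere_eigenvalues _ \<mu> \<longleftrightarrow>
     incseq \<mu> \<and>
     (\<forall>l. finite {m. \<mu> m = l} \<and>
          card {m. \<mu> m = l} =
            vector_space.dim (\<lambda>(a::real) f x. a * f x) (sphere_eigenspace l :: ('a \<Rightarrow> real) set))"

definition A_coef :: "nat \<Rightarrow> real \<Rightarrow> (nat \<Rightarrow> real) \<Rightarrow> nat \<Rightarrow> real" where
  "A_coef n \<gamma> \<mu> m = 1/2 + \<gamma>/2 + 1/2 * sqrt ((real n / 2 - 1)\<^sup>2 + \<mu> m)"

definition B_coef :: "nat \<Rightarrow> real \<Rightarrow> (nat \<Rightarrow> real) \<Rightarrow> nat \<Rightarrow> real" where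
  "B_coef n \<gamma> \<mu> m = 1/2 - \<gamma>/2 + 1/2 * sqrt ((real n / 2 - 1)\<^sup>2 + \<mu> m)"

text \<open>As \<open>Gamma\<close> is 0 at its poles and division by 0 gives 0, this has the correct value 0 at the
  poles of the denominator; at the poles of the numerator the value is irrelevant below.\<close>

definition Theta :: "nat \<Rightarrow> real \<Rightarrow> (nat \<Rightarrow> real) \<Rightarrow> nat \<Rightarrow> complex \<Rightarrow> complex" where
  "Theta n \<gamma> \<mu> m z =
     complex_of_real (2 powr (2 * \<gamma>)) *
     (Gamma (of_real (A_coef n \<gamma> \<mu> m) + z * \<i> / 2) * Gamma (of_real (A_coef n \<gamma> \<mu> m) - z * \<i> / 2)) /
     (Gamma (of_real (B_coef n \<gamma> \<mu> m) + z * \<i> / 2) * Gamma (of_real (B_coef n \<gamma> \<mu> m) - z * \<i> / 2))"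

definition pole_parameters ::
  "nat \<Rightarrow> real \<Rightarrow> (nat \<Rightarrow> real) \<Rightarrow> nat \<Rightarrow> real \<Rightarrow> (nat \<Rightarrow> real) \<Rightarrow> (nat \<Rightarrow> real) \<Rightarrow> bool" where
  "pole_parameters n \<gamma> \<mu> m \<kappa> \<sigma> \<tau> \<longleftrightarrow>
     {z. is_pole (\<lambda>z. 1 / (Theta n \<gamma> \<mu> m z - of_real \<kappa>)) z} =
       (\<Union>j. {Complex (\<tau> j) (\<sigma> j), Complex (\<tau> j) (- \<sigma> j),
             Complex (- \<tau> j) (\<sigma> j), Complex (- \<tau> j) (- \<sigma> j)}) \<and>
     inj (\<lambda>j. (\<sigma> j, \<tau> j)) \<and>
     \<tau> 0 = 0 \<and> (\<forall>j. \<tau> j \<ge> 0) \<and> eventually (\<lambda>j. \<tau> j = 0) sequentially \<and>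
     \<sigma> 0 > 0 \<and> (\<forall>j\<ge>1. \<sigma> j > \<sigma> 0)"

definition fourier :: "(real \<Rightarrow> real) \<Rightarrow> real \<Rightarrow> complex" where
  "fourier f \<xi> = (LINT t|lebesgue. exp (- (\<i> * of_real (\<xi> * t))) * complex_of_real (f t))"

text \<open>The equation \<open>P w - \<kappa> w = h\<close>, where \<open>P\<close> is the Fourier multiplier with symbol
  \<open>Theta n \<gamma> \<mu> m\<close>, for integrable \<open>w\<close> and \<open>h\<close>.\<close>

definition solves_mode ::
  "nat \<Rightarrow> real \<Rightarrow> (nat \<Rightarrow> real) \<Rightarrow> nat \<Rightarrow> real \<Rightarrow> (real \<Rightarrow> real) \<Rightarrow> (real \<Rightarrow> real) \<Rightarrow> bool" where
  "solves_mode n \<gamma> \<mu> m \<kappa> w h \<longleftrightarrow>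
     integrable lebesgue w \<and> integrable lebesgue h \<and>
     (\<forall>\<xi>. Theta n \<gamma> \<mu> m (of_real \<xi>) * fourier w \<xi> - of_real \<kappa> * fourier w \<xi> = fourier h \<xi>)"

definition conv :: "(real \<Rightarrow> real) \<Rightarrow> (real \<Rightarrow> real) \<Rightarrow> real \<Rightarrow> real" where
  "conv G h t = (LINT t'|lebesgue. G (t - t') * h t')"

definition green_function ::
  "nat \<Rightarrow> real \<Rightarrow> (nat \<Rightarrow> real) \<Rightarrow> nat \<Rightarrow> real \<Rightarrow> (real \<Rightarrow> real) \<Rightarrow> bool" where
  "green_function n \<gamma> \<mu> m \<kappa> G \<longleftrightarrow>
     integrable lebesgue G \<and>
     (\<forall>h. integrable lebesgue h \<longrightarrow> solves_mode n \<gamma> \<mu> m \<kappa> (conv G h) h)"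

text \<open>The expansion of the Green's function. It is not required at \<open>t = 0\<close>, where the Green's
  function is singular when \<open>\<gamma> \<le> 1/2\<close>.\<close>

definition green_expansion ::
  "(nat \<Rightarrow> real) \<Rightarrow> (nat \<Rightarrow> real) \<Rightarrow> (nat \<Rightarrow> real) \<Rightarrow> (nat \<Rightarrow> real) \<Rightarrow> (real \<Rightarrow> real) \<Rightarrow> bool" where
  "green_expansion \<sigma> \<tau> c c' G \<longleftrightarrow>
     (\<forall>t. t \<noteq> 0 \<longrightarrow>
        summable (\<lambda>j. exp (- \<sigma> (Suc j) * \<bar>t\<bar>) *
          (c (Suc j) * cos (\<tau> (Suc j) * \<bar>t\<bar>) + c' (Suc j) * sin (\<tau> (Suc j) * \<bar>t\<bar>))) \<and>
        G t = c 0 * exp (- \<sigma> 0 * \<bar>t\<bar>) +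
          (\<Sum>j. exp (- \<sigma> (Suc j) * \<bar>t\<bar>) *
            (c (Suc j) * cos (\<tau> (Suc j) * \<bar>t\<bar>) + c' (Suc j) * sin (\<tau> (Suc j) * \<bar>t\<bar>))))"

text \<open>The equation \<open>- (1/z) W'' + z W = 2 h\<close> for a locally integrable \<open>h\<close>: \<open>W\<close> is differentiable,
  \<open>W'\<close> is an indefinite integral of \<open>W''\<close>, and \<open>W''\<close> is the classical derivative of \<open>W'\<close> wherever
  \<open>h\<close> is continuous. For continuous \<open>h\<close> this is the classical equation.\<close>

definition solves_ode :: "complex \<Rightarrow> (real \<Rightarrow> real) \<Rightarrow> (real \<Rightarrow> complex) \<Rightarrow> bool" where
  "solves_ode z h W \<longleftrightarrow>
     (\<exists>W' W''.
        (\<forall>t. (W has_vector_derivative W' t) (at t)) \<and>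
        (\<forall>a b. a \<le> b \<longrightarrow> W'' absolutely_integrable_on {a..b} \<and>
                        (W'' has_integral (W' b - W' a)) {a..b}) \<and>
        (\<forall>t. isCont h t \<longrightarrow> (W' has_vector_derivative W'' t) (at t)) \<and>
        (\<forall>t. - (1 / z) * W'' t + z * W t = 2 * of_real (h t)))"

end

theory Submission imports Defs
begin

text \<open>In the variable \<open>-z\<^sup>2/4\<close>, the symbol \<open>\<Theta>\<close> is a meromorphic function with positive interlacing
  zeros and poles, so it maps each open half plane into one. Hence every solution of
  \<open>\<Theta>(z) = \<kappa>\<close> off the real axis is imaginary: all \<open>\<tau>\<close> vanish, the exponentials are real and the
  sine terms, which \<open>Re (\<Sum>j. c j * W j t)\<close> does not see, are absent. The half plane property also makes
  \<open>\<Theta>\<close> monotone between consecutive poles on the imaginary axis, so there are few \<open>\<sigma>\<close> and the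
  expansion of \<open>G\<close> converges absolutely, and it fixes the sign of the residues of
  \<open>1 / (\<Theta> - \<kappa>)\<close>, so that all \<open>c j\<close> are nonnegative. The partial sums of the expansion are then
  dominated by \<open>G\<close> itself, however singular it is at the origin, and the series may be
  integrated term by term.\<close>

text \<open>The data enter through \<open>A_coef\<close> and \<open>B_coef\<close>: their difference
  is \<gamma>, in (0,1), and their sum is 1 plus a square root. The root must be shown nonnegative,
  hence the detour through the eigenvalues of the sphere: the real \<open>sqrt\<close> is odd, so a
  negative argument would make it negative.

  The obstacle is that the \<open>c j\<close> are not given by a formula. They are coefficients of a
  series converging pointwise off the origin, and \<open>G\<close> is tied to the symbol only by a
  Fourier identity on the real line, from which the residues have to be recovered. This recovery
  integrates the series termwise away from the origin, so absolute convergence cannot be a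
  consequence of the signs: it is deduced beforehand, from pointwise convergence and the sparsity of
  the \<open>\<sigma> j\<close>.

  The signs are used at the diagonal t' = t. Absolute convergence off the origin gives nothing
  uniform there, and the sum of the absolute values might be far larger than \<bar>G\<bar>. For
  nonnegative terms the two agree, so termwise integration is valid at each single t at which the
  convolution integral exists.\<close>

subsection \<open>Eigenvalues of the sphere\<close>

text \<open>\<open>laplacian\<close> iterates \<open>deriv\<close>, which is a mere choice value
  where no derivative exists. This supplies genuine derivatives along a line, F'(x + s b) b and
  F''(x) b b, before anything is said about \<open>laplacian\<close>.\<close>

lemma C2_on_line_derivatives:
  fixes F :: "'a::euclidean_space \<Rightarrow> real"
  assumes C2: "C2_on F U" and U: "open U" and x: "x \<in> U"
  obtains S D where "open S" "0 \<in> S" "\<And>s. s \<in> S \<Longrightarrow> x + s *\<^sub>R b \<in> U"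
    "\<And>s. s \<in> S \<Longrightarrow> (\<lambda>s. F (x + s *\<^sub>R b)) field_differentiable (at s)"
    "(deriv (\<lambda>s. F (x + s *\<^sub>R b)) has_real_derivative D) (at 0)"
proof -
  obtain F' :: "'a \<Rightarrow> 'a \<Rightarrow>\<^sub>L real" and F'' :: "'a \<Rightarrow> 'a \<Rightarrow>\<^sub>L ('a \<Rightarrow>\<^sub>L real)" where
    F': "\<And>x. x \<in> U \<Longrightarrow> (F has_derivative blinfun_apply (F' x)) (at x)" and
    F'': "\<And>x. x \<in> U \<Longrightarrow> (F' has_derivative blinfun_apply (F'' x)) (at x)"
    using C2 unfolding C2_on_def by blast
  define \<phi> where "\<phi> = (\<lambda>s. F (x + s *\<^sub>R b))"
  define S where "S = (\<lambda>s. x + s *\<^sub>R b) -` U"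
  have S: "open S" "0 \<in> S"
    unfolding S_def using x by (auto intro!: open_vimage U continuous_intros)
  have d1: "(\<phi> has_real_derivative blinfun_apply (F' (x + s *\<^sub>R b)) b) (at s)" if "s \<in> S" for s
  proof -
    have "(\<phi> has_derivative (\<lambda>r. blinfun_apply (F' (x + s *\<^sub>R b)) (r *\<^sub>R b))) (at s)"
      unfolding \<phi>_def
      by (rule has_derivative_compose[where g = F, OF _ F'])
         (use that in \<open>auto intro!: derivative_eq_intros simp: S_def\<close>)
    then show ?thesis
      by (rule has_derivative_imp_has_field_derivative) (simp add: blinfun.scaleR_right)
  qed
  have ev: "eventually (\<lambda>s. s \<in> S) (nhds 0)"
    using S by (simp add: eventually_nhds_in_open)
  have d2: "(deriv \<phi> has_real_derivative blinfun_apply (blinfun_apply (F'' x) b) b) (at 0)"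
  proof -
    have "((\<lambda>s. F' (x + s *\<^sub>R b)) has_derivative (\<lambda>r. blinfun_apply (F'' x) (r *\<^sub>R b))) (at 0)"
      by (rule has_derivative_compose[where g = F'])
         (use x F''[OF x] in \<open>auto intro!: derivative_eq_intros\<close>)
    then have "((\<lambda>s. blinfun_apply (F' (x + s *\<^sub>R b)) b) has_derivative
        (\<lambda>r. blinfun_apply (blinfun_apply (F'' x) (r *\<^sub>R b)) b)) (at 0)"
      by (auto intro!: derivative_eq_intros)
    then have "((\<lambda>s. blinfun_apply (F' (x + s *\<^sub>R b)) b) has_real_derivative
        blinfun_apply (blinfun_apply (F'' x) b) b) (at 0)"
      by (rule has_derivative_imp_has_field_derivative)
         (simp add: blinfun.scaleR_right blinfun.scaleR_left)
    then show ?thesis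
      by (rule DERIV_cong_ev[THEN iffD1, rotated -1])
         (auto intro!: eventually_mono[OF ev] simp: DERIV_imp_deriv[OF d1])
  qed
  show thesis
    using that[of S, OF S] d1 d2 by (auto simp: S_def \<phi>_def field_differentiable_def)
qed

text \<open>If the second derivative were positive, the first one, which vanishes at the maximum,
  would be positive just to the right of it, and the mean value theorem would produce a larger value
  inside U.\<close>

lemma second_deriv_nonpos_at_max:
  fixes F :: "'a::euclidean_space \<Rightarrow> real"
  assumes C2: "C2_on F U" and U: "open U" and x: "x \<in> U" and max: "\<And>y. y \<in> U \<Longrightarrow> F y \<le> F x"
  shows "deriv (deriv (\<lambda>s. F (x + s *\<^sub>R b))) 0 \<le> 0"
proof -
  define \<phi> where "\<phi> = (\<lambda>s. F (x + s *\<^sub>R b))"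
  obtain S D where S: "open S" "0 \<in> S" "\<And>s. s \<in> S \<Longrightarrow> x + s *\<^sub>R b \<in> U"
    and diff: "\<And>s. s \<in> S \<Longrightarrow> \<phi> field_differentiable (at s)"
    and d2: "(deriv \<phi> has_real_derivative D) (at 0)"
    unfolding \<phi>_def using C2_on_line_derivatives[OF C2 U x] by blast
  have d1: "(\<phi> has_real_derivative deriv \<phi> s) (at s)" if "s \<in> S" for s
    using diff[OF that] by (simp add: DERIV_deriv_iff_field_differentiable)
  obtain e where e: "e > 0" "ball 0 e \<subseteq> S"
    using S openE by blast
  have "deriv \<phi> 0 = 0"
  proof -
    have "\<phi> s \<le> \<phi> 0" if "\<bar>0 - s\<bar> < e" for s
      using S(3)[of s] e(2) that max by (auto simp: \<phi>_def subset_iff dist_real_def)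
    then show ?thesis
      using DERIV_local_max[OF d1[OF S(2)] e(1)] by blast
  qed
  have "\<not> 0 < D"
  proof
    assume "0 < D"
    then obtain r where r: "r > 0" "\<And>h. 0 < h \<Longrightarrow> h < r \<Longrightarrow> deriv \<phi> 0 < deriv \<phi> h"
      using DERIV_pos_inc_right[OF d2] by auto
    define l where "l = min r e / 2"
    have l: "0 < l" "l < r" "l < e"
      using r e by (auto simp: l_def)
    have d: "(\<phi> has_real_derivative deriv \<phi> s) (at s)" if "0 \<le> s" "s \<le> l" for s
      using e(2) that l by (intro d1) (auto simp: subset_iff dist_real_def)
    obtain z where z: "0 < z" "z < l" "\<phi> l - \<phi> 0 = (l - 0) * deriv \<phi> z"
      using MVT2[OF l(1), of \<phi> "deriv \<phi>"] d by blast
    have "\<phi> l > \<phi> 0"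
      using z l r(2)[of z] \<open>deriv \<phi> 0 = 0\<close> by (auto simp: zero_less_mult_iff algebra_simps)
    moreover have "x + l *\<^sub>R b \<in> U"
      using e(2) l by (intro S(3)) (auto simp: subset_iff dist_real_def)
    ultimately show False
      using max[of "x + l *\<^sub>R b"] by (simp add: \<phi>_def)
  qed
  then show ?thesis
    using DERIV_imp_deriv[OF d2] by (simp add: \<phi>_def)
qed

lemma laplacian_nonpos_at_max:
  fixes F :: "'a::euclidean_space \<Rightarrow> real"
  assumes "C2_on F U" "open U" "x \<in> U" "\<And>y. y \<in> U \<Longrightarrow> F y \<le> F x"
  shows "laplacian F x \<le> 0"
  unfolding laplacian_def by (intro sum_nonpos second_deriv_nonpos_at_max[OF assms])

lemma C2_on_imp_continuous_on: "C2_on F U \<Longrightarrow> continuous_on U F"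
  unfolding C2_on_def
  by (meson continuous_at_imp_continuous_on has_derivative_continuous)

lemma C2_on_uminus:
  assumes "C2_on F U"
  shows "C2_on (\<lambda>x. - F x) U"
proof -
  obtain F' F'' where F: "\<And>x. x \<in> U \<Longrightarrow> (F has_derivative blinfun_apply (F' x)) (at x)"
    "\<And>x. x \<in> U \<Longrightarrow> (F' has_derivative blinfun_apply (F'' x)) (at x)" "continuous_on U F''"
    using assms unfolding C2_on_def by blast
  have "((\<lambda>x. - F x) has_derivative blinfun_apply (- F' x)) (at x)"
    "((\<lambda>x. - F' x) has_derivative blinfun_apply (- F'' x)) (at x)" if "x \<in> U" for x
    using has_derivative_minus[OF F(1)[OF that]] has_derivative_minus[OF F(2)[OF that]]
    by (simp_all add: blinfun.minus_left[abs_def])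
  then show ?thesis
    unfolding C2_on_def using continuous_on_minus[OF F(3)] by (intro exI conjI ballI)
qed

text \<open>Differentiability matters even for a change of sign: the choice value that
  \<open>deriv\<close> takes at a function without derivative does not change sign with the
  function.\<close>

lemma laplacian_uminus:
  fixes F :: "'a::euclidean_space \<Rightarrow> real"
  assumes "C2_on F U" "open U" "x \<in> U"
  shows "laplacian (\<lambda>x. - F x) x = - laplacian F x"
proof -
  have "deriv (deriv (\<lambda>s. - F (x + s *\<^sub>R b))) 0 = - deriv (deriv (\<lambda>s. F (x + s *\<^sub>R b))) 0" for b
  proof -
    define \<phi> where "\<phi> = (\<lambda>s. F (x + s *\<^sub>R b))"
    obtain S D where S: "open S" "0 \<in> S"
      and diff: "\<And>s. s \<in> S \<Longrightarrow> \<phi> field_differentiable (at s)"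
      and d2: "(deriv \<phi> has_real_derivative D) (at 0)"
      by (rule C2_on_line_derivatives[OF assms, of b, folded \<phi>_def]) (rule that)
    have "deriv (\<lambda>s. - \<phi> s) s = - deriv \<phi> s" if "s \<in> S" for s
      using diff[OF that] by (intro DERIV_imp_deriv derivative_intros)
        (simp add: DERIV_deriv_iff_field_differentiable)
    then have "deriv (deriv (\<lambda>s. - \<phi> s)) 0 = deriv (\<lambda>s. - deriv \<phi> s) 0"
      using S by (intro deriv_cong_ev) (auto simp: eventually_nhds)
    also have "\<dots> = - deriv (deriv \<phi>) 0"
      by (intro DERIV_imp_deriv derivative_intros) (use d2 in \<open>simp add: DERIV_imp_deriv\<close>)
    finally show ?thesis
      by (simp add: \<phi>_def)
  qed
  then show ?thesis
    by (simp add: laplacian_def sum_negf)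
qed

lemma sphere_eigenspace_uminus:
  fixes f :: "'a::euclidean_space \<Rightarrow> real"
  assumes "f \<in> sphere_eigenspace l"
  shows "(\<lambda>x. - f x) \<in> sphere_eigenspace l"
proof -
  have "laplacian (\<lambda>x. - radial_ext f x) x = - laplacian (radial_ext f) x" if "x \<in> sphere 0 1" for x
    using assms that by (intro laplacian_uminus[of _ "- {0}"]) (auto simp: sphere_eigenspace_def)
  moreover have "radial_ext (\<lambda>x. - f x) = (\<lambda>x. - radial_ext f x)"
    by (auto simp: radial_ext_def)
  ultimately show ?thesis
    using assms by (auto simp: sphere_eigenspace_def intro: C2_on_uminus)
qed

text \<open>Maximum principle. The radial extension is constant on rays, so its maximum p over the
  sphere is a maximum over the punctured space, where the Laplacian is nonpositive. Hence l f(p)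
  \<ge> 0, and f(p) \<ge> f(x) > 0.\<close>

lemma sphere_eigenvalue_nonneg_if_pos:
  fixes f :: "'a::euclidean_space \<Rightarrow> real"
  assumes f: "f \<in> sphere_eigenspace l" and pos: "f x > 0"
  shows "l \<ge> 0"
proof -
  have C2: "C2_on (radial_ext f) (- {0})"
    and eig: "\<And>x. x \<in> sphere 0 1 \<Longrightarrow> - laplacian (radial_ext f) x = l * f x"
    using f by (auto simp: sphere_eigenspace_def)
  have x: "x \<in> sphere 0 1"
    using f pos by (force simp: sphere_eigenspace_def)
  have "continuous_on (sphere 0 1) (radial_ext f)"
    by (rule continuous_on_subset[OF C2_on_imp_continuous_on[OF C2]]) auto
  then obtain p where p: "p \<in> sphere 0 1" "\<And>y. y \<in> sphere 0 1 \<Longrightarrow> radial_ext f y \<le> radial_ext f p"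
    using continuous_attains_sup[of "sphere 0 1" "radial_ext f"] x by auto
  have "radial_ext f y \<le> radial_ext f p" if "y \<noteq> 0" for y
    using p(2)[of "y /\<^sub>R norm y"] that by (simp add: radial_ext_def)
  then have "laplacian (radial_ext f) p \<le> 0"
    using p(1) by (intro laplacian_nonpos_at_max[OF C2]) auto
  moreover have "f p > 0"
    using p(1) p(2)[OF x] pos x by (simp add: radial_ext_def)
  ultimately show ?thesis
    using eig[OF p(1)] by (metis neg_0_le_iff_le zero_le_mult_iff not_less)
qed

text \<open>A listed value has multiplicity at least 1, so its eigenspace has nonzero dimension and
  contains a nonzero function f. One of f and -f is positive somewhere.\<close>

lemma sphere_eigenvalues_nonneg:
  assumes "sphere_eigenvalues TYPE('a::euclidean_space) \<mu>"
  shows "\<mu> m \<ge> 0"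
proof -
  interpret V: vector_space "\<lambda>(a::real) (f::'a \<Rightarrow> real) x. a * f x"
    by unfold_locales (auto simp: algebra_simps)
  let ?E = "sphere_eigenspace (\<mu> m) :: ('a \<Rightarrow> real) set"
  have mult: "finite {k. \<mu> k = \<mu> m}" "card {k. \<mu> k = \<mu> m} = V.dim ?E"
    using assms by (simp_all add: sphere_eigenvalues_def)
  have "V.dim ?E \<noteq> 0"
    unfolding mult(2)[symmetric] card_eq_0_iff using mult(1) by auto
  moreover have "V.dim ?E = 0" if "?E \<subseteq> {0}"
    using V.dim_unique[of "{}" ?E 0] that by (simp add: V.independent_empty)
  ultimately have "\<not> ?E \<subseteq> {0}"
    by (rule contrapos_nn)
  then obtain f where f: "f \<in> ?E" "f \<noteq> 0"
    by auto
  then obtain x where "f x \<noteq> 0"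
    by (auto simp: fun_eq_iff)
  then consider "f x > 0" | "- f x > 0"
    by linarith
  then show ?thesis
    using sphere_eigenvalue_nonneg_if_pos f(1) sphere_eigenspace_uminus[OF f(1)] by cases blast+
qed

subsection \<open>The symbol in the right half plane\<close>

text \<open>This form of the argument is a genuine real number, not a class modulo 2 pi, and
  decreases in x at fixed height q. Order relations between real parts thereby become order
  relations between angles.\<close>

lemma upper_half_plane_polar:
  assumes "q > 0"
  shows "Complex x q = of_real (cmod (Complex x q)) * cis (pi / 2 - arctan (x / q))"
proof -
  have "sqrt (1 + (x / q)\<^sup>2) = cmod (Complex x q) / q"
  proof -
    have "1 + (x / q)\<^sup>2 = (x\<^sup>2 + q\<^sup>2) / q\<^sup>2"
      using assms by (simp add: field_simps)
    then show ?thesis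
      using assms by (simp add: cmod_def real_sqrt_divide)
  qed
  then show ?thesis
    using assms
    by (simp add: complex_eq_iff cos_diff sin_diff cos_arctan sin_arctan)
qed

lemma prod_norm_cis:
  "(\<Prod>k\<in>A. of_real (r k) * cis (f k)) = of_real (\<Prod>k\<in>A. r k) * cis (\<Sum>k\<in>A. f k)"
  by (induction A rule: infinite_finite_induct) (simp_all add: cis_mult[symmetric] ac_simps)

text \<open>Gauss's limit formula for Gamma. The factorials cancel, and pairing u with -u removes u
  from the exponentials, so besides the product only the positive real n^(2(a - b)) is left, which
  does not affect the argument.\<close>

lemma Gamma_series_quotient:
  fixes u :: complex and a b :: real
  assumes "n > 0"
  shows "Gamma_series (of_real a + u) n * Gamma_series (of_real a - u) n *
           (rGamma_series (of_real b + u) n * rGamma_series (of_real b - u) n) =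
         of_real (exp (2 * (a - b) * ln n)) *
           (\<Prod>k\<le>n. (of_real ((b + real k)\<^sup>2) - u\<^sup>2) / (of_real ((a + real k)\<^sup>2) - u\<^sup>2))"
proof -
  have P: "pochhammer (of_real c + u) (n + 1) * pochhammer (of_real c - u) (n + 1) =
      (\<Prod>k\<le>n. of_real ((c + real k)\<^sup>2) - u\<^sup>2)" for c :: real
    by (simp add: pochhammer_prod prod.distrib[symmetric] lessThan_Suc_atMost atLeast0LessThan power2_eq_square algebra_simps)
  have E: "exp ((of_real c + u) * of_real (ln n)) * exp ((of_real c - u) * of_real (ln n)) =
      complex_of_real (exp (2 * c * ln n))" for c :: real
    unfolding exp_of_real[symmetric] by (simp add: exp_add[symmetric] algebra_simps)
  define pa where "pa = pochhammer (of_real a + u) (n + 1)"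
  define pa' where "pa' = pochhammer (of_real a - u) (n + 1)"
  define pb where "pb = pochhammer (of_real b + u) (n + 1)"
  define pb' where "pb' = pochhammer (of_real b - u) (n + 1)"
  define ea where "ea = exp ((of_real a + u) * of_real (ln n))"
  define ea' where "ea' = exp ((of_real a - u) * of_real (ln n))"
  define eb where "eb = exp ((of_real b + u) * of_real (ln n))"
  define eb' where "eb' = exp ((of_real b - u) * of_real (ln n))"
  have "Gamma_series (of_real a + u) n * Gamma_series (of_real a - u) n *
           (rGamma_series (of_real b + u) n * rGamma_series (of_real b - u) n) =
      fact n * ea / pa * (fact n * ea' / pa') * (pb / (fact n * eb) * (pb' / (fact n * eb')))"
    by (simp add: Gamma_series_def rGamma_series_def pa_def pa'_def pb_def pb'_def
          ea_def ea'_def eb_def eb'_def)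
  also have "\<dots> = (ea * ea') / (eb * eb') * ((pb * pb') / (pa * pa'))"
    by (simp add: ac_simps)
  also have "\<dots> = of_real (exp (2 * a * ln n) / exp (2 * b * ln n)) *
      ((\<Prod>k\<le>n. of_real ((b + real k)\<^sup>2) - u\<^sup>2) / (\<Prod>k\<le>n. of_real ((a + real k)\<^sup>2) - u\<^sup>2))"
    unfolding pa_def pa'_def pb_def pb'_def ea_def ea'_def eb_def eb'_def P E by simp
  finally show ?thesis
    by (simp add: prod_dividef exp_diff[symmetric] algebra_simps)
qed

text \<open>Zeros \<open>(b + k)\<^sup>2\<close> and poles \<open>(a + k)\<^sup>2\<close> of the quotient, as a function of \<open>u\<^sup>2\<close>, interlace.
  Hence the arguments of the factors of its product expansion add up to less than \<open>\<pi>\<close>.\<close>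

lemma Im_Gamma_quotient_pos:
  fixes u :: complex and a b :: real
  assumes ab: "0 < a + b" "b < a" "a < b + 1" and u: "Im (u\<^sup>2) < 0"
  shows "Im (Gamma (of_real a + u) * Gamma (of_real a - u) *
           (rGamma (of_real b + u) * rGamma (of_real b - u))) > 0"
proof -
  \<comment> \<open>x^2 - u^2 has real part x^2 + p and imaginary part q, so all factors of the
    product lie on one horizontal line in the upper half plane and their angles pi/2 - \<theta> x
    are ordered by x^2.\<close>
  define q where "q = - Im (u\<^sup>2)"
  define p where "p = - Re (u\<^sup>2)"
  have q: "q > 0"
    using u by (simp add: q_def)
  define \<theta> where "\<theta> x = arctan ((x\<^sup>2 + p) / q)" for x
  have \<theta>: "\<theta> x < \<theta> y" if "x\<^sup>2 < y\<^sup>2" for x y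
    using that q by (simp add: \<theta>_def arctan_less_iff divide_strict_right_mono)
  define \<Phi> where "\<Phi> n = (\<Sum>k\<le>n. \<theta> (a + k) - \<theta> (b + k))" for n :: nat
  define Q where "Q n = Gamma_series (of_real a + u) n * Gamma_series (of_real a - u) n *
           (rGamma_series (of_real b + u) n * rGamma_series (of_real b - u) n)" for n
  define L where "L = Gamma (of_real a + u) * Gamma (of_real a - u) *
           (rGamma (of_real b + u) * rGamma (of_real b - u))"
  have lim: "Q \<longlonglongrightarrow> L"
    unfolding Q_def L_def by (intro tendsto_intros)
  have Im_u: "Im u \<noteq> 0"
    using u by (auto simp: power2_eq_square)
  have nonpole: "of_real c + u \<notin> \<int>\<^sub>\<le>\<^sub>0" "of_real c - u \<notin> \<int>\<^sub>\<le>\<^sub>0" for c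
    using Im_u by (auto elim!: nonpos_Ints_cases simp: complex_eq_iff)
  have L0: "L \<noteq> 0"
    using nonpole by (simp add: L_def Gamma_eq_zero_iff rGamma_eq_zero_iff)
  have lt1: "(b + real k)\<^sup>2 < (a + real k)\<^sup>2" for k
  proof -
    have "0 < (a - b) * (a + b + 2 * real k)"
      using ab by (intro mult_pos_pos) auto
    then show ?thesis
      by (simp add: power2_eq_square algebra_simps)
  qed
  have lt2: "(a + real k)\<^sup>2 < (b + real (Suc k))\<^sup>2" for k
  proof -
    have "0 < (b + 1 - a) * (a + b + 2 * real k + 1)"
      using ab by (intro mult_pos_pos) auto
    then show ?thesis
      by (simp add: power2_eq_square algebra_simps)
  qed
  have factor: "of_real (x\<^sup>2) - u\<^sup>2 = of_real (cmod (of_real (x\<^sup>2) - u\<^sup>2)) * cis (pi / 2 - \<theta> x)" for x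
  proof -
    have "of_real (x\<^sup>2) - u\<^sup>2 = Complex (x\<^sup>2 + p) q"
      by (auto simp: complex_eq_iff p_def q_def simp del: of_real_power)
    then show ?thesis
      using upper_half_plane_polar[OF q, of "x\<^sup>2 + p"] by (simp add: \<theta>_def)
  qed
  have polar: "Q n = of_real (cmod (Q n)) * cis (\<Phi> n)" if "n > 0" for n
  proof -
    have "(of_real ((b + k)\<^sup>2) - u\<^sup>2) / (of_real ((a + k)\<^sup>2) - u\<^sup>2) =
        of_real (cmod (of_real ((b + k)\<^sup>2) - u\<^sup>2) / cmod (of_real ((a + k)\<^sup>2) - u\<^sup>2)) *
        cis (\<theta> (a + k) - \<theta> (b + k))" for k :: nat
    proof -
      have "\<theta> (a + k) - \<theta> (b + k) = (pi / 2 - \<theta> (b + k)) - (pi / 2 - \<theta> (a + k))"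
        by simp
      then show ?thesis
        by (subst factor[of "b + k"], subst factor[of "a + k"])
          (simp only: cis_divide[symmetric] of_real_divide times_divide_times_eq)
    qed
    then have "\<exists>r\<ge>0. Q n = of_real r * cis (\<Phi> n)"
      unfolding Q_def Gamma_series_quotient[OF that]
      by (subst prod.cong[OF refl], assumption, subst prod_norm_cis, unfold \<Phi>_def)
        (auto intro!: exI[of _ "exp (2 * (a - b) * ln (real n)) *
           (\<Prod>k\<le>n. cmod (of_real ((b + real k)\<^sup>2) - u\<^sup>2) / cmod (of_real ((a + real k)\<^sup>2) - u\<^sup>2))"]
          mult_nonneg_nonneg prod_nonneg simp del: of_real_power)
    then show ?thesis
      by (auto simp: norm_mult)
  qed
  have inc: "incseq \<Phi>"
  proof (intro incseq_SucI)
    fix n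
    show "\<Phi> n \<le> \<Phi> (Suc n)"
      using \<theta>[OF lt1[of "Suc n"]] by (simp add: \<Phi>_def)
  qed
  \<comment> \<open>The intervals from (b + k)^2 to (a + k)^2 are disjoint and ordered by
    interlacing, so the increments of \<theta> over them add up to at most its increment from b to a
    + n.\<close>
  have le: "\<Phi> n \<le> \<theta> (a + n) - \<theta> b" for n
  proof (induction n)
    case (Suc n)
    then show ?case
      using \<theta>[OF lt2[of n]] by (simp add: \<Phi>_def)
  qed (simp add: \<Phi>_def)
  have ub: "\<Phi> n \<le> pi / 2 - \<theta> b" for n
    using le[of n] arctan_ubound[of "((a + n)\<^sup>2 + p) / q"] by (simp add: \<theta>_def)
  obtain \<phi> where \<phi>: "\<Phi> \<longlonglongrightarrow> \<phi>" "\<And>n. \<Phi> n \<le> \<phi>"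
    using incseq_convergent[OF inc, of "pi / 2 - \<theta> b"] ub by blast
  \<comment> \<open>Strictness survives the limit on both sides: \<Phi> increases from a positive
    first term, and its upper bound pi/2 - \<theta> b is itself less than pi.\<close>
  have "0 < \<Phi> 0"
    using \<theta>[OF lt1[of 0]] by (simp add: \<Phi>_def)
  with \<phi>(2)[of 0] have "0 < \<phi>"
    by simp
  moreover have "\<phi> \<le> pi / 2 - \<theta> b"
    by (rule LIMSEQ_le_const2[OF \<phi>(1)]) (use ub in auto)
  then have "\<phi> < pi"
    using arctan_lbound[of "(b\<^sup>2 + p) / q"] by (simp add: \<theta>_def)
  ultimately have "sin \<phi> > 0"
    by (rule sin_gt_zero)
  have "(\<lambda>n. of_real (cmod (Q n)) * cis (\<Phi> n)) \<longlonglongrightarrow> of_real (cmod L) * cis \<phi>"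
    unfolding cis_conv_exp by (intro tendsto_intros lim \<phi>)
  moreover have "eventually (\<lambda>n. of_real (cmod (Q n)) * cis (\<Phi> n) = Q n) sequentially"
    using eventually_gt_at_top[of 0] by eventually_elim (use polar in simp)
  ultimately have "Q \<longlonglongrightarrow> of_real (cmod L) * cis \<phi>"
    by (rule Lim_transform_eventually)
  then have "L = of_real (cmod L) * cis \<phi>"
    using lim LIMSEQ_unique by blast
  then have "Im L = Im (of_real (cmod L) * cis \<phi>)"
    by (rule arg_cong)
  then show ?thesis
    using L0 \<open>sin \<phi> > 0\<close> by (simp add: L_def)
qed

text \<open>With the entire function \<open>rGamma\<close> in place of a division, the symbol is
  visibly holomorphic, with zeros, at the poles of the denominator; only the numerator restricts the
  domain.\<close>

definition Gamma_symbol :: "real \<Rightarrow> real \<Rightarrow> real \<Rightarrow> complex \<Rightarrow> complex" where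
  "Gamma_symbol C a b z = of_real C *
     (Gamma (of_real a + z * \<i> / 2) * Gamma (of_real a - z * \<i> / 2) *
      (rGamma (of_real b + z * \<i> / 2) * rGamma (of_real b - z * \<i> / 2)))"

lemma Theta_eq_Gamma_symbol:
  "Theta n \<gamma> \<mu> m = Gamma_symbol (2 powr (2 * \<gamma>)) (A_coef n \<gamma> \<mu> m) (B_coef n \<gamma> \<mu> m)"
  by (simp add: fun_eq_iff Theta_def Gamma_symbol_def rGamma_inverse_Gamma divide_simps)

text \<open>For u = i z/2 the imaginary part of u^2 is -(Re z)(Im z)/2, so the open first quadrant
  is sent to the half plane where the quotient estimate applies.\<close>

lemma Im_Gamma_symbol_pos:
  assumes "C > 0" "0 < a + b" "b < a" "a < b + 1" "Re z > 0" "Im z > 0"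
  shows "Im (Gamma_symbol C a b z) > 0"
proof -
  have "Im ((z * \<i> / 2)\<^sup>2) < 0"
    using assms by (simp add: power2_eq_square)
  then show ?thesis
    using Im_Gamma_quotient_pos[of a b "z * \<i> / 2"] assms by (simp add: Gamma_symbol_def)
qed

definition Gamma_symbol_regular :: "real \<Rightarrow> complex set" where
  "Gamma_symbol_regular a =
     {z. of_real a + z * \<i> / 2 \<notin> \<int>\<^sub>\<le>\<^sub>0 \<and> of_real a - z * \<i> / 2 \<notin> \<int>\<^sub>\<le>\<^sub>0}"

lemma open_Gamma_symbol_regular: "open (Gamma_symbol_regular a)"
proof -
  have "Gamma_symbol_regular a = (\<lambda>z. of_real a + z * \<i> / 2) -` (- \<int>\<^sub>\<le>\<^sub>0) \<inter> (\<lambda>z. of_real a - z * \<i> / 2) -` (- \<int>\<^sub>\<le>\<^sub>0)"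
    by (auto simp: Gamma_symbol_regular_def)
  also have "open \<dots>"
    by (intro open_Int open_vimage open_Compl closed_nonpos_Ints continuous_intros) auto
  finally show ?thesis .
qed

lemma holomorphic_Gamma_symbol: "Gamma_symbol C a b holomorphic_on Gamma_symbol_regular a"
  unfolding Gamma_symbol_def[abs_def]
  by (intro holomorphic_intros) (auto simp: Gamma_symbol_regular_def)

lemma Gamma_symbol_regular_Re: "Re z \<noteq> 0 \<Longrightarrow> z \<in> Gamma_symbol_regular a"
  by (auto simp: Gamma_symbol_regular_def complex_eq_iff elim!: nonpos_Ints_cases)

section \<open>Location and separation of the poles of
  \<open>1 / (Gamma_symbol C a b z - \<kappa>)\<close>\<close>

lemma Gamma_symbol_eq_if_is_pole:
  assumes pole: "is_pole (\<lambda>z. 1 / (Gamma_symbol C a b z - of_real \<kappa>)) z"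
    and z: "z \<in> Gamma_symbol_regular a"
  shows "Gamma_symbol C a b z = of_real \<kappa>"
proof (rule ccontr)
  assume neq: "Gamma_symbol C a b z \<noteq> of_real \<kappa>"
  have "isCont (Gamma_symbol C a b) z"
    using holomorphic_on_imp_continuous_on[OF holomorphic_Gamma_symbol] z open_Gamma_symbol_regular
    by (simp add: continuous_on_eq_continuous_at)
  then have "((\<lambda>z. 1 / (Gamma_symbol C a b z - of_real \<kappa>)) \<longlongrightarrow>
      1 / (Gamma_symbol C a b z - of_real \<kappa>)) (at z)"
    using neq by (intro tendsto_intros) (auto simp: isCont_def)
  with pole show False
    by (auto simp: is_pole_def intro: not_tendsto_and_filterlim_at_infinity[rotated])
qed

text \<open>Off the imaginary axis the symbol is regular, so a pole would force it to equal the real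
  number \<kappa> at a point of the open quadrant, where its imaginary part is positive.\<close>

lemma is_pole_Gamma_symbol_axes:
  assumes ab: "C > 0" "0 < a + b" "b < a" "a < b + 1"
    and pole: "is_pole (\<lambda>z. 1 / (Gamma_symbol C a b z - of_real \<kappa>)) z"
    and "Re z \<ge> 0" "Im z > 0"
  shows "Re z = 0"
  using Gamma_symbol_eq_if_is_pole[OF pole Gamma_symbol_regular_Re] Im_Gamma_symbol_pos[OF ab, of z] assms(6,7)
  by force

lemma Gamma_symbol_imaginary_axis:
  "Gamma_symbol C a b (\<i> * of_real y) \<in> \<real>"
proof -
  have *: "of_real c + \<i> * of_real y * \<i> / 2 = complex_of_real (c - y / 2)"
    "of_real c - \<i> * of_real y * \<i> / 2 = complex_of_real (c + y / 2)" for c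
    by (simp_all add: complex_eq_iff)
  show ?thesis
    unfolding Gamma_symbol_def *
    by (simp only: Gamma_complex_of_real rGamma_complex_of_real of_real_mult[symmetric] Reals_of_real)
qed

text \<open>On the imaginary axis the symbol is real, and to the right of it the imaginary part is
  positive. The difference quotient in the real direction therefore shows Im D \<ge> 0 for the
  complex derivative D, while the derivative along the axis is i D, with real part - Im D.\<close>

lemma Gamma_symbol_decreasing:
  assumes ab: "C > 0" "0 < a + b" "b < a" "a < b + 1"
    and "0 < y1" "y1 \<le> y2" and reg: "\<And>y. y1 \<le> y \<Longrightarrow> y \<le> y2 \<Longrightarrow> \<i> * of_real y \<in> Gamma_symbol_regular a"
  shows "Re (Gamma_symbol C a b (\<i> * of_real y2)) \<le> Re (Gamma_symbol C a b (\<i> * of_real y1))"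
proof (rule DERIV_nonpos_imp_nonincreasing[OF \<open>y1 \<le> y2\<close>])
  fix y assume y: "y1 \<le> y" "y \<le> y2"
  let ?T = "Gamma_symbol C a b"
  let ?z = "\<i> * of_real y"
  obtain D where D: "(?T has_field_derivative D) (at ?z)"
    using holomorphic_Gamma_symbol open_Gamma_symbol_regular reg[OF y]
    by (metis DERIV_deriv_iff_field_differentiable holomorphic_on_imp_differentiable_at)
  have lim: "((\<lambda>x::real. (?T (?z + of_real x) - ?T ?z) / of_real x) \<longlongrightarrow> D) (at_right 0)"
  proof -
    have "((\<lambda>h. (?T (?z + h) - ?T ?z) / h) \<longlongrightarrow> D) (at 0)"
      using D by (simp add: DERIV_def)
    moreover have "filterlim complex_of_real (at 0) (at_right 0)"
      by (auto simp: filterlim_at eventually_at_filter intro!: tendsto_eq_intros)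
    ultimately show ?thesis
      by (rule filterlim_compose)
  qed
  have "0 \<le> Im D"
  proof (rule tendsto_lowerbound[OF tendsto_Im[OF lim]])
    have "Im (?T ?z) = 0"
      using Gamma_symbol_imaginary_axis[of C a b y] by (simp add: complex_is_Real_iff)
    then have "0 \<le> Im ((?T (?z + of_real x) - ?T ?z) / of_real x)" if "x > 0" for x
      using that y assms(5) Im_Gamma_symbol_pos[OF ab, of "?z + of_real x"] by (simp add: Im_divide_of_real)
    then show "\<forall>\<^sub>F x in at_right 0. 0 \<le> Im ((?T (?z + of_real x) - ?T ?z) / of_real x)"
      by (auto simp: eventually_at_filter)
  qed simp
  moreover have "((\<lambda>y. Re (?T (\<i> * of_real y))) has_real_derivative - Im D) (at y)"
  proof -
    have "((\<lambda>y. ?T (\<i> * of_real y)) has_vector_derivative \<i> * D) (at y)"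
      by (rule field_vector_diff_chain_at[where f = "\<lambda>y. \<i> * of_real y" and g = ?T, OF _ D, unfolded o_def])
        (auto intro!: derivative_eq_intros has_vector_derivative_of_real)
    from bounded_linear.has_vector_derivative[OF bounded_linear_Re this] show ?thesis
      by (simp add: has_real_derivative_iff_has_vector_derivative)
  qed
  ultimately show "\<exists>d. ((\<lambda>y. Re (?T (\<i> * of_real y))) has_real_derivative d) (at y) \<and> d \<le> 0"
    by (intro exI[of _ "- Im D"]) auto
qed

text \<open>Two poles would give the monotone symbol the same value \<kappa> at both ends of the
  segment, hence on all of it. But near a pole the symbol differs from \<kappa>.\<close>

lemma is_pole_Gamma_symbol_unique:
  assumes ab: "C > 0" "0 < a + b" "b < a" "a < b + 1"
    and "0 < y1" "y1 \<le> y2" and reg: "\<And>y. y1 \<le> y \<Longrightarrow> y \<le> y2 \<Longrightarrow> \<i> * of_real y \<in> Gamma_symbol_regular a"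
    and pole: "is_pole (\<lambda>z. 1 / (Gamma_symbol C a b z - of_real \<kappa>)) (\<i> * of_real y1)"
      "is_pole (\<lambda>z. 1 / (Gamma_symbol C a b z - of_real \<kappa>)) (\<i> * of_real y2)"
  shows "y1 = y2"
proof (rule ccontr)
  assume "y1 \<noteq> y2"
  then have "y1 < y2"
    using \<open>y1 \<le> y2\<close> by simp
  let ?T = "Gamma_symbol C a b"
  have eq: "?T (\<i> * of_real y) = of_real \<kappa>" if y: "y1 \<le> y" "y \<le> y2" for y
  proof -
    have "Re (?T (\<i> * of_real y)) \<le> Re (?T (\<i> * of_real y1))"
      "Re (?T (\<i> * of_real y2)) \<le> Re (?T (\<i> * of_real y))"
      using Gamma_symbol_decreasing[OF ab, of y1 y] Gamma_symbol_decreasing[OF ab, of y y2] reg y assms(5)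
      by auto
    moreover have "?T (\<i> * of_real y1) = of_real \<kappa>" "?T (\<i> * of_real y2) = of_real \<kappa>"
      using Gamma_symbol_eq_if_is_pole[OF pole(1) reg] Gamma_symbol_eq_if_is_pole[OF pole(2) reg] \<open>y1 \<le> y2\<close>
      by auto
    ultimately show ?thesis
      using Gamma_symbol_imaginary_axis[of C a b y] by (simp add: complex_eq_iff complex_is_Real_iff)
  qed
  have "eventually (\<lambda>z. ?T z \<noteq> of_real \<kappa>) (at (\<i> * of_real y1))"
  proof -
    \<comment> \<open>Since 1 / 0 = 0, nonvanishing of this quotient says exactly that the symbol is
      not \<kappa>.\<close>
    have "eventually (\<lambda>z. 1 / (?T z - of_real \<kappa>) \<noteq> 0) (at (\<i> * of_real y1))"
      using pole(1) unfolding is_pole_def by (rule filterlim_at_infinity_imp_eventually_ne)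
    then show ?thesis
      by eventually_elim auto
  qed
  moreover have "filterlim (\<lambda>y. \<i> * of_real y) (at (\<i> * of_real y1)) (at_right y1)"
    by (auto simp: filterlim_at eventually_at_filter intro!: tendsto_eq_intros)
  ultimately have "eventually (\<lambda>y. ?T (\<i> * of_real y) \<noteq> of_real \<kappa>) (at_right y1)"
    by (rule eventually_compose_filterlim)
  moreover have "eventually (\<lambda>y. y \<in> {y1<..<y2}) (at_right y1)"
    using \<open>y1 < y2\<close> by (rule eventually_at_right_real)
  ultimately have "eventually (\<lambda>y. False) (at_right y1)"
    by eventually_elim (use eq in auto)
  then show False
    by simp
qed

text \<open>There is at most one pole between two consecutive poles of the symbol, so the parameters
  grow at least linearly however they are ordered.\<close>

lemma summable_exp_if_separated:
  fixes \<sigma> :: "nat \<Rightarrow> real" and a x :: real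
  assumes "x > 0" and a: "a > 0" and pos: "\<And>j. \<sigma> j > 0"
    and inj: "\<And>j k. j \<noteq> k \<Longrightarrow> \<sigma> j \<le> \<sigma> k \<Longrightarrow> \<exists>i::int. \<sigma> j / 2 - a \<le> of_int i \<and> of_int i \<le> \<sigma> k / 2 - a \<and> \<sigma> j < \<sigma> k"
  shows "summable (\<lambda>j. exp (- \<sigma> j * x))"
proof -
  define v where "v j = \<sigma> j / 2 - a" for j
  define N where "N = \<lceil>a\<rceil>"
  \<comment> \<open>A cell between consecutive integers can hold two of the \<open>v j\<close>: one
    inside and one at its right end. The parity of \<open>K\<close> tells these apart, and the shift
    by \<open>N\<close> makes the code a natural number because \<open>v j > - a\<close>.\<close>
  define K where "K j = 2 * nat (\<lceil>v j\<rceil> + N) + (if of_int \<lceil>v j\<rceil> = v j then 1 else 0)" for j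
  have nonneg: "\<lceil>v j\<rceil> + N \<ge> 0" for j
    using pos[of j] a unfolding v_def N_def by linarith
  have "inj K"
  proof (rule injI, rule ccontr)
    fix j k assume K: "K j = K k" and "j \<noteq> k"
    have *: False if jk: "j \<noteq> k" "\<sigma> j \<le> \<sigma> k" and K: "K j = K k" for j k
    proof -
      have "nat (\<lceil>v j\<rceil> + N) = nat (\<lceil>v k\<rceil> + N)"
        and iff: "of_int \<lceil>v j\<rceil> = v j \<longleftrightarrow> of_int \<lceil>v k\<rceil> = v k"
        using arg_cong[OF K, of "\<lambda>n. n div 2"] arg_cong[OF K, of even] by (auto simp: K_def split: if_splits)
      then have eq: "\<lceil>v j\<rceil> = \<lceil>v k\<rceil>"
        using nonneg[of j] nonneg[of k] by linarith
      obtain i :: int where i: "v j \<le> of_int i" "of_int i \<le> v k" "v j < v k"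
        using inj[OF jk] by (auto simp: v_def)
      have "\<lceil>v k\<rceil> \<le> i"
        using i(1) eq by (simp add: ceiling_le_iff flip: eq)
      then have "of_int \<lceil>v k\<rceil> = v k"
        using i(2) le_of_int_ceiling[of "v k"] by linarith
      then show False
        using iff eq i by auto
    qed
    show False
      using *[of j k] *[of k j] K \<open>j \<noteq> k\<close> by (cases "\<sigma> j \<le> \<sigma> k") auto
  qed
  have "summable (\<lambda>n. exp (- x) ^ n)"
    using \<open>x > 0\<close> by (intro summable_geometric) auto
  then have "summable (\<lambda>j. exp (- x) ^ K j)"
    using summable_reindex[OF _ \<open>inj K\<close>] by (simp add: o_def)
  \<comment> \<open>The 5 bounds \<open>K j - \<sigma> j\<close>: the ceilings of \<open>v j\<close>
    and \<open>a\<close> each round up by at most 1, their sum is doubled, and the parity adds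
    1.\<close>
  then have "summable (\<lambda>j. exp (5 * x) * exp (- x) ^ K j)"
    by (rule summable_mult)
  then show ?thesis
  proof (rule summable_comparison_test'[where N = 0])
    fix j
    have "real (K j) \<le> 2 * (of_int \<lceil>v j\<rceil> + of_int N) + 1"
      using nonneg[of j] by (auto simp: K_def)
    also have "\<dots> \<le> \<sigma> j + 5"
    proof -
      have "2 * (x + y) + 1 \<le> s + 5" if "x \<le> s / 2 - a + 1" "y \<le> a + 1" for x y s :: real
        using that by simp
      then show ?thesis
        using of_int_ceiling_le_add_one[of "v j"] of_int_ceiling_le_add_one[of a]
        unfolding v_def N_def by blast
    qed
    finally have "x * real (K j) \<le> x * (\<sigma> j + 5)"
      using \<open>x > 0\<close> by simp
    then show "norm (exp (- \<sigma> j * x)) \<le> exp (5 * x) * exp (- x) ^ K j"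
      by (simp add: exp_of_nat_mult[symmetric] exp_add[symmetric] algebra_simps)
  qed
qed

text \<open>By uniqueness on regular segments, two of the \<sigma> enclose some y at which the
  numerator is singular. The argument a + y/2 is positive, so the singular factor is Gamma at a -
  y/2, and y/2 - a is the integer that separates.\<close>

lemma summable_exp_poles:
  assumes ab: "C > 0" "0 < a + b" "b < a" "a < b + 1" and "x > 0"
    and "\<And>j. \<sigma> j > 0" "inj \<sigma>"
    and pole: "\<And>j. is_pole (\<lambda>z. 1 / (Gamma_symbol C a b z - of_real \<kappa>)) (\<i> * of_real (\<sigma> j))"
  shows "summable (\<lambda>j. exp (- \<sigma> j * x))"
proof (rule summable_exp_if_separated[OF \<open>x > 0\<close>, where a = a])
  show a: "a > 0"
    using ab by linarith
  fix j k :: nat assume jk: "j \<noteq> k" "\<sigma> j \<le> \<sigma> k"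
  then have "\<sigma> j < \<sigma> k"
    using \<open>inj \<sigma>\<close> by (metis injD order_le_less)
  then have "\<exists>y\<in>{\<sigma> j..\<sigma> k}. \<i> * of_real y \<notin> Gamma_symbol_regular a"
    using is_pole_Gamma_symbol_unique[OF ab _ jk(2) _ pole pole] assms(6) by force
  then obtain y where y: "\<sigma> j \<le> y" "y \<le> \<sigma> k" "\<i> * of_real y \<notin> Gamma_symbol_regular a"
    by auto
  have *: "of_real a + \<i> * of_real y * \<i> / 2 = complex_of_real (a - y / 2)"
    "of_real a - \<i> * of_real y * \<i> / 2 = complex_of_real (a + y / 2)"
    by (simp_all add: complex_eq_iff)
  have "0 < y"
    using y assms(6)[of j] by linarith
  have "complex_of_real (a - y / 2) \<in> \<int>\<^sub>\<le>\<^sub>0 \<or> complex_of_real (a + y / 2) \<in> \<int>\<^sub>\<le>\<^sub>0"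
    using y(3) unfolding Gamma_symbol_regular_def mem_Collect_eq * by blast
  then obtain i :: int where "y / 2 - a = of_int i"
  proof
    assume "complex_of_real (a - y / 2) \<in> \<int>\<^sub>\<le>\<^sub>0"
    then obtain n where "complex_of_real (a - y / 2) = - of_nat n"
      by (elim nonpos_Ints_cases')
    then have "a - y / 2 = - real n"
      by (simp add: complex_eq_iff)
    then show thesis
      by (intro that[of "int n"]) simp
  next
    assume "complex_of_real (a + y / 2) \<in> \<int>\<^sub>\<le>\<^sub>0"
    then obtain n where "complex_of_real (a + y / 2) = - of_nat n"
      by (elim nonpos_Ints_cases')
    then have "a + y / 2 = - real n"
      by (simp add: complex_eq_iff)
    then show thesis
      using a \<open>0 < y\<close> by simp
  qed
  then show "\<exists>i::int. \<sigma> j / 2 - a \<le> of_int i \<and> of_int i \<le> \<sigma> k / 2 - a \<and> \<sigma> j < \<sigma> k"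
    using y \<open>\<sigma> j < \<sigma> k\<close> by (intro exI[of _ i]) auto
qed (use assms in auto)

subsection \<open>Convolution with a two-sided exponential\<close>

text \<open>Domination is a Lipschitz bound centred at t, and differentiability is asked only at
  this t for almost every x: the kernels to be differentiated have a kink whose position moves with
  the parameter. The field is generic because real and complex parameters both occur.\<close>

lemma has_field_derivative_integral:
  fixes f :: "'a::{real_normed_field, banach, second_countable_topology} \<Rightarrow> 'b \<Rightarrow> 'a"
  assumes r: "r > 0" and int: "\<And>s. dist s t < r \<Longrightarrow> integrable M (f s)"
    and der: "AE x in M. ((\<lambda>s. f s x) has_field_derivative f' x) (at t)"
    and meas: "f' \<in> borel_measurable M"
    and dom: "\<And>s. dist s t < r \<Longrightarrow> AE x in M. norm (f s x - f t x) \<le> B x * norm (s - t)"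
    and B: "integrable M B"
  shows "((\<lambda>s. LINT x|M. f s x) has_field_derivative (LINT x|M. f' x)) (at t)"
proof -
  have "((\<lambda>s. ((LINT x|M. f s x) - (LINT x|M. f t x)) / (s - t)) \<longlongrightarrow> (LINT x|M. f' x)) (at t)"
    unfolding tendsto_at_iff_sequentially
  proof (intro allI impI)
    fix X :: "nat \<Rightarrow> 'a" assume neq: "\<forall>i. X i \<in> UNIV - {t}" and X: "X \<longlonglongrightarrow> t"
    obtain N where N: "\<And>n. n \<ge> N \<Longrightarrow> dist (X n) t < r"
      using X r unfolding lim_sequentially by blast
    define Y where "Y n = X (n + N)" for n
    have Y: "Y \<longlonglongrightarrow> t" "\<And>n. Y n \<noteq> t" "\<And>n. dist (Y n) t < r"
      using LIMSEQ_ignore_initial_segment[OF X, of N] neq N by (auto simp: Y_def[abs_def])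
    have t: "dist t t < r"
      using r by simp
    have "(\<lambda>n. LINT x|M. (f (Y n) x - f t x) / (Y n - t)) \<longlonglongrightarrow> (LINT x|M. f' x)"
    proof (rule integral_dominated_convergence[OF meas _ B])
      show "(\<lambda>x. (f (Y n) x - f t x) / (Y n - t)) \<in> borel_measurable M" for n
        using int[OF Y(3)[of n]] int[OF t] by measurable
      show "AE x in M. (\<lambda>n. (f (Y n) x - f t x) / (Y n - t)) \<longlonglongrightarrow> f' x"
        using der
      proof eventually_elim
        case (elim x)
        then have "((\<lambda>s. (f s x - f t x) / (s - t)) \<longlongrightarrow> f' x) (at t)"
          by (simp add: has_field_derivative_iff)
        moreover have "filterlim Y (at t) sequentially"
          using Y by (simp add: filterlim_at)
        ultimately show ?case
          by (rule filterlim_compose)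
      qed
      show "AE x in M. norm ((f (Y n) x - f t x) / (Y n - t)) \<le> B x" for n
        using dom[OF Y(3)[of n]]
        by eventually_elim (use Y(2)[of n] in \<open>simp add: norm_divide divide_le_eq\<close>)
    qed
    moreover have "(LINT x|M. (f (Y n) x - f t x) / (Y n - t)) =
        ((LINT x|M. f (Y n) x) - (LINT x|M. f t x)) / (Y n - t)" for n
      using int[OF Y(3)[of n]] int[OF t] by simp
    ultimately have "(\<lambda>n. ((\<lambda>s. ((LINT x|M. f s x) - (LINT x|M. f t x)) / (s - t)) \<circ> X) (n + N))
        \<longlonglongrightarrow> (LINT x|M. f' x)"
      by (simp only: Y_def o_def)
    then show "((\<lambda>s. ((LINT x|M. f s x) - (LINT x|M. f t x)) / (s - t)) \<circ> X)
        \<longlonglongrightarrow> (LINT x|M. f' x)"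
      by (rule LIMSEQ_offset)
  qed
  then show ?thesis
    by (simp add: has_field_derivative_iff)
qed

lemma abs_exp_diff_le: "\<bar>exp x - exp y\<bar> \<le> \<bar>x - y\<bar> * exp (max x y)" for x y :: real
proof (induction x y rule: linorder_wlog)
  case (le x y)
  have "1 - exp (x - y) \<le> y - x"
    using exp_ge_add_one_self[of "x - y"] by linarith
  then have "exp y * (1 - exp (x - y)) \<le> exp y * (y - x)"
    by simp
  then show ?case
    using le by (simp add: right_diff_distrib exp_diff mult.commute)
qed (simp add: abs_minus_commute max.commute)

text \<open>Weighted integrability is the one form in which growth of h is used. By the triangle
  inequality (\<open>exp_shift\<close>) a weight centred at 0 controls a kernel centred at any t, at
  the price of a factor depending on t.\<close>

locale exp_weighted =
  fixes \<sigma> :: real and h :: "real \<Rightarrow> real"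
  assumes sigma_pos: "\<sigma> > 0"
    and integrable_weighted: "integrable lebesgue (\<lambda>t. exp (- \<sigma> * \<bar>t\<bar>) * h t)"
begin

lemma measurable_h [measurable]: "h \<in> borel_measurable lebesgue"
proof -
  have "(\<lambda>t. exp (\<sigma> * \<bar>t\<bar>) * (exp (- \<sigma> * \<bar>t\<bar>) * h t)) \<in> borel_measurable lebesgue"
    by (intro borel_measurable_times borel_measurable_integrable[OF integrable_weighted])
       (auto intro!: borel_measurable_continuous_onI continuous_intros measurable_completion)
  then show ?thesis
    by (simp add: mult.assoc[symmetric] exp_add[symmetric])
qed

lemma exp_shift: "exp (- \<sigma> * \<bar>t - t'\<bar>) \<le> exp (\<sigma> * \<bar>t\<bar>) * exp (- \<sigma> * \<bar>t'\<bar>)" for t t' :: real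
  using sigma_pos mult_left_mono[of "\<bar>t'\<bar>" "\<bar>t\<bar> + \<bar>t - t'\<bar>" \<sigma>] by (simp add: exp_add[symmetric] algebra_simps)

lemma integrable_kernel:
  assumes k: "k \<in> borel_measurable lebesgue" and bound: "\<And>t'. \<bar>k t'\<bar> \<le> C * exp (- \<sigma> * \<bar>t'\<bar>)"
  shows "integrable lebesgue (\<lambda>t'. k t' * h t')"
proof (rule Bochner_Integration.integrable_bound)
  show "integrable lebesgue (\<lambda>t'. C * (exp (- \<sigma> * \<bar>t'\<bar>) * h t'))"
    by (intro integrable_mult_right integrable_weighted)
  show "(\<lambda>t'. k t' * h t') \<in> borel_measurable lebesgue"
    using k by measurable
  have "\<bar>k t'\<bar> * \<bar>h t'\<bar> \<le> (C * exp (- \<sigma> * \<bar>t'\<bar>)) * \<bar>h t'\<bar>" for t'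
    using bound by (intro mult_right_mono) auto
  moreover have "C \<ge> 0"
    using order_trans[OF abs_ge_zero bound[of 0]] by simp
  ultimately show "AE t' in lebesgue. norm (k t' * h t') \<le> norm (C * (exp (- \<sigma> * \<bar>t'\<bar>) * h t'))"
    by (simp add: abs_mult mult.assoc)
qed

definition kernel_conv :: "real \<Rightarrow> real" where
  "kernel_conv t = (LINT t'|lebesgue. exp (- \<sigma> * \<bar>t - t'\<bar>) * h t')"

definition kernel_conv' :: "real \<Rightarrow> real" where
  "kernel_conv' t = (LINT t'|lebesgue. - \<sigma> * sgn (t - t') * exp (- \<sigma> * \<bar>t - t'\<bar>) * h t')"

lemma integrable_exp_kernel: "integrable lebesgue (\<lambda>t'. exp (- \<sigma> * \<bar>t - t'\<bar>) * h t')"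
  by (rule integrable_kernel[where C = "exp (\<sigma> * \<bar>t\<bar>)"])
     (use exp_shift in \<open>auto intro!: measurable_completion\<close>)

lemma integrable_exp_kernel': "integrable lebesgue (\<lambda>t'. - \<sigma> * sgn (t - t') * exp (- \<sigma> * \<bar>t - t'\<bar>) * h t')"
proof (rule integrable_kernel[where C = "\<sigma> * exp (\<sigma> * \<bar>t\<bar>)"])
  have "\<bar>sgn (t - t')\<bar> * exp (- \<sigma> * \<bar>t - t'\<bar>) \<le> 1 * (exp (\<sigma> * \<bar>t\<bar>) * exp (- \<sigma> * \<bar>t'\<bar>))" for t'
    using exp_shift[of t t'] by (intro mult_mono) (auto simp: sgn_if)
  then show "\<bar>- \<sigma> * sgn (t - t') * exp (- \<sigma> * \<bar>t - t'\<bar>)\<bar> \<le> \<sigma> * exp (\<sigma> * \<bar>t\<bar>) * exp (- \<sigma> * \<bar>t'\<bar>)" for t'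
    using sigma_pos by (simp add: abs_mult mult.assoc)
qed (auto intro!: measurable_completion)

lemma AE_neq: "AE t' in lebesgue. t' \<noteq> (t::real)"
  by (rule AE_completion) (rule AE_lborel_singleton)

lemma has_derivative_kernel_conv: "(kernel_conv has_real_derivative kernel_conv' t) (at t)"
  unfolding kernel_conv_def[abs_def] kernel_conv'_def
proof (rule has_field_derivative_integral[where r = 1 and B = "\<lambda>t'. \<sigma> * exp (\<sigma> + \<sigma> * \<bar>t\<bar>) * \<bar>exp (- \<sigma> * \<bar>t'\<bar>) * h t'\<bar>"])
  show "AE t' in lebesgue. ((\<lambda>s. exp (- \<sigma> * \<bar>s - t'\<bar>) * h t') has_real_derivative
      - \<sigma> * sgn (t - t') * exp (- \<sigma> * \<bar>t - t'\<bar>) * h t') (at t)"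
    using AE_neq[of t]
  proof eventually_elim
    case (elim t')
    have "((\<lambda>s. \<bar>s - t'\<bar>) has_real_derivative sgn (t - t')) (at t)"
    proof (cases "t > t'")
      case True
      have "((\<lambda>s. s - t') has_real_derivative sgn (t - t')) (at t)"
        using True by (auto intro!: derivative_eq_intros)
      then show ?thesis
        by (rule has_field_derivative_transform_within_open[of _ _ _ "{t'<..}"]) (use True in auto)
    next
      case False
      have "((\<lambda>s. t' - s) has_real_derivative sgn (t - t')) (at t)"
        using False elim by (auto intro!: derivative_eq_intros)
      then show ?thesis
        by (rule has_field_derivative_transform_within_open[of _ _ _ "{..<t'}"]) (use False elim in auto)
    qed
    then show ?case
      by (auto intro!: derivative_eq_intros)
  qed
  show "(\<lambda>t'. - \<sigma> * sgn (t - t') * exp (- \<sigma> * \<bar>t - t'\<bar>) * h t') \<in> borel_measurable lebesgue"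
    using integrable_exp_kernel' by (rule borel_measurable_integrable)
  show "integrable lebesgue (\<lambda>t'. \<sigma> * exp (\<sigma> + \<sigma> * \<bar>t\<bar>) * \<bar>exp (- \<sigma> * \<bar>t'\<bar>) * h t'\<bar>)"
    by (intro integrable_mult_right integrable_abs integrable_weighted)
next
  fix s :: real assume s: "dist s t < 1"
  have "\<bar>exp (- \<sigma> * \<bar>s - t'\<bar>) - exp (- \<sigma> * \<bar>t - t'\<bar>)\<bar> \<le>
      \<sigma> * exp (\<sigma> + \<sigma> * \<bar>t\<bar>) * exp (- \<sigma> * \<bar>t'\<bar>) * \<bar>s - t\<bar>" for t'
  proof -
    have "\<bar>exp (- \<sigma> * \<bar>s - t'\<bar>) - exp (- \<sigma> * \<bar>t - t'\<bar>)\<bar> \<le>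
        \<bar>- \<sigma> * \<bar>s - t'\<bar> - - \<sigma> * \<bar>t - t'\<bar>\<bar> * exp (max (- \<sigma> * \<bar>s - t'\<bar>) (- \<sigma> * \<bar>t - t'\<bar>))"
      by (rule abs_exp_diff_le)
    also have "\<dots> \<le> (\<sigma> * \<bar>s - t\<bar>) * exp (\<sigma> + \<sigma> * \<bar>t\<bar> - \<sigma> * \<bar>t'\<bar>)"
    proof (intro mult_mono)
      have "- \<sigma> * \<bar>s - t'\<bar> - - \<sigma> * \<bar>t - t'\<bar> = \<sigma> * (\<bar>t - t'\<bar> - \<bar>s - t'\<bar>)"
        by (simp add: algebra_simps)
      then show "\<bar>- \<sigma> * \<bar>s - t'\<bar> - - \<sigma> * \<bar>t - t'\<bar>\<bar> \<le> \<sigma> * \<bar>s - t\<bar>"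
        using sigma_pos by (simp add: abs_mult)
      \<comment> \<open>Both \<bar>s - t'\<bar> and \<bar>t - t'\<bar> are at least \<bar>t'\<bar> -
        \<bar>t\<bar> - 1 because s is within 1 of t. This is the origin of exp(\<sigma> +
        \<sigma>\<bar>t\<bar>) in the dominating function.\<close>
      have "\<sigma> * (\<bar>t'\<bar> - \<bar>t\<bar> - 1) \<le> \<sigma> * \<bar>s - t'\<bar>" "\<sigma> * (\<bar>t'\<bar> - \<bar>t\<bar> - 1) \<le> \<sigma> * \<bar>t - t'\<bar>"
        using sigma_pos s by (auto simp: dist_real_def)
      then show "exp (max (- \<sigma> * \<bar>s - t'\<bar>) (- \<sigma> * \<bar>t - t'\<bar>)) \<le> exp (\<sigma> + \<sigma> * \<bar>t\<bar> - \<sigma> * \<bar>t'\<bar>)"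
        by (simp add: max_def algebra_simps)
    qed (use sigma_pos in auto)
    finally show ?thesis
      by (simp add: exp_add exp_diff exp_minus field_simps)
  qed
  then have "\<bar>exp (- \<sigma> * \<bar>s - t'\<bar>) - exp (- \<sigma> * \<bar>t - t'\<bar>)\<bar> * \<bar>h t'\<bar> \<le>
      \<sigma> * exp (\<sigma> + \<sigma> * \<bar>t\<bar>) * exp (- \<sigma> * \<bar>t'\<bar>) * \<bar>s - t\<bar> * \<bar>h t'\<bar>" for t'
    by (intro mult_right_mono) auto
  moreover have "\<bar>exp (- \<sigma> * \<bar>s - t'\<bar>) * h t' - exp (- \<sigma> * \<bar>t - t'\<bar>) * h t'\<bar> =
      \<bar>exp (- \<sigma> * \<bar>s - t'\<bar>) - exp (- \<sigma> * \<bar>t - t'\<bar>)\<bar> * \<bar>h t'\<bar>" for t'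
    by (simp only: left_diff_distrib[symmetric] abs_mult)
  ultimately show "AE t' in lebesgue. norm (exp (- \<sigma> * \<bar>s - t'\<bar>) * h t' - exp (- \<sigma> * \<bar>t - t'\<bar>) * h t')
      \<le> \<sigma> * exp (\<sigma> + \<sigma> * \<bar>t\<bar>) * \<bar>exp (- \<sigma> * \<bar>t'\<bar>) * h t'\<bar> * norm (s - t)"
    by (simp add: abs_mult ac_simps)
qed (use integrable_exp_kernel in auto)

text \<open>The differentiated kernel -\<sigma> sgn(x) exp(-\<sigma>\<bar>x\<bar>) with its downward
  jump at 0 filled by adding 2\<sigma> on the right. What results is the antiderivative of
  \<sigma>^2 exp(-\<sigma>\<bar>x\<bar>) that vanishes at minus infinity.\<close>

definition smooth_step :: "real \<Rightarrow> real" where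
  "smooth_step x = (if x \<ge> 0 then \<sigma> * (2 - exp (- \<sigma> * x)) else \<sigma> * exp (\<sigma> * x))"

lemma smooth_step_diff_le:
  assumes "\<bar>x - y\<bar> < 1"
  shows "\<bar>smooth_step x - smooth_step y\<bar> \<le> \<sigma>\<^sup>2 * \<bar>x - y\<bar> * exp (\<sigma> - \<sigma> * \<bar>y\<bar>)"
proof -
  have exp_diff: "\<bar>\<sigma> * exp (\<sigma> * u) - \<sigma> * exp (\<sigma> * v)\<bar> \<le> \<sigma>\<^sup>2 * \<bar>u - v\<bar> * exp M"
    if "\<sigma> * u \<le> M" "\<sigma> * v \<le> M" for u v M
  proof -
    have "\<bar>exp (\<sigma> * u) - exp (\<sigma> * v)\<bar> \<le> \<bar>\<sigma> * u - \<sigma> * v\<bar> * exp (max (\<sigma> * u) (\<sigma> * v))"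
      by (rule abs_exp_diff_le)
    also have "\<dots> \<le> \<sigma> * \<bar>u - v\<bar> * exp M"
      using that sigma_pos by (intro mult_mono) (auto simp: right_diff_distrib[symmetric] abs_mult)
    finally have "\<sigma> * \<bar>exp (\<sigma> * u) - exp (\<sigma> * v)\<bar> \<le> \<sigma> * (\<sigma> * \<bar>u - v\<bar> * exp M)"
      using sigma_pos by (intro mult_left_mono) auto
    then show ?thesis
      using sigma_pos by (simp add: right_diff_distrib[symmetric] abs_mult power2_eq_square mult.assoc)
  qed
  have le: "- (\<sigma> * \<bar>x\<bar>) \<le> \<sigma> - \<sigma> * \<bar>y\<bar>" "- (\<sigma> * \<bar>y\<bar>) \<le> \<sigma> - \<sigma> * \<bar>y\<bar>"
    using mult_left_mono[of "\<bar>y\<bar>" "1 + \<bar>x\<bar>" \<sigma>] assms sigma_pos by (auto simp: algebra_simps)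
  consider "x \<ge> 0" "y \<ge> 0" | "x < 0" "y < 0" | "x \<ge> 0" "y < 0" | "x < 0" "y \<ge> 0"
    by linarith
  then show ?thesis
  proof cases
    case 1
    then show ?thesis
      using exp_diff[of "- y" "\<sigma> - \<sigma> * \<bar>y\<bar>" "- x"] le by (simp add: smooth_step_def algebra_simps)
  next
    case 2
    then show ?thesis
      using exp_diff[of x "\<sigma> - \<sigma> * \<bar>y\<bar>" y] le by (simp add: smooth_step_def)
  next
    \<comment> \<open>Across 0 the difference is split at the common value \<sigma> =
      \<open>smooth_step 0\<close>, and \<bar>x - y\<bar> = \<bar>x\<bar> + \<bar>y\<bar>. As
      \<bar>y\<bar> < 1, the exponent \<sigma> - \<sigma>\<bar>y\<bar> is nonnegative and so
      dominates the exponent 0 at the splitting point.\<close>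
    case 3
    then have "\<sigma> * \<bar>y\<bar> \<le> \<sigma>" "\<sigma> * x \<ge> 0"
      using sigma_pos assms mult_left_le[of "\<bar>y\<bar>" \<sigma>] by auto
    then have "\<bar>\<sigma> * exp (\<sigma> * 0) - \<sigma> * exp (\<sigma> * - x)\<bar> \<le> \<sigma>\<^sup>2 * \<bar>0 - - x\<bar> * exp (\<sigma> - \<sigma> * \<bar>y\<bar>)"
      "\<bar>\<sigma> * exp (\<sigma> * 0) - \<sigma> * exp (\<sigma> * y)\<bar> \<le> \<sigma>\<^sup>2 * \<bar>0 - y\<bar> * exp (\<sigma> - \<sigma> * \<bar>y\<bar>)"
      using le 3 by (intro exp_diff; simp)+
    then show ?thesis
      using 3 by (simp add: smooth_step_def algebra_simps)
  next
    case 4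
    then have "\<sigma> * \<bar>y\<bar> \<le> \<sigma>" "\<sigma> * y \<ge> 0"
      using sigma_pos assms mult_left_le[of "\<bar>y\<bar>" \<sigma>] by auto
    then have "\<bar>\<sigma> * exp (\<sigma> * 0) - \<sigma> * exp (\<sigma> * - y)\<bar> \<le> \<sigma>\<^sup>2 * \<bar>0 - - y\<bar> * exp (\<sigma> - \<sigma> * \<bar>y\<bar>)"
      "\<bar>\<sigma> * exp (\<sigma> * 0) - \<sigma> * exp (\<sigma> * x)\<bar> \<le> \<sigma>\<^sup>2 * \<bar>0 - x\<bar> * exp (\<sigma> - \<sigma> * \<bar>y\<bar>)"
      using le 4 by (intro exp_diff; simp)+
    then show ?thesis
      using 4 by (simp add: smooth_step_def algebra_simps)
  qed
qed

lemma has_derivative_smooth_step: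
  assumes "x \<noteq> 0"
  shows "(smooth_step has_real_derivative \<sigma>\<^sup>2 * exp (- \<sigma> * \<bar>x\<bar>)) (at x)"
proof (cases "x > 0")
  case True
  have "((\<lambda>x. \<sigma> * (2 - exp (- \<sigma> * x))) has_real_derivative \<sigma>\<^sup>2 * exp (- \<sigma> * \<bar>x\<bar>)) (at x)"
    using True by (auto intro!: derivative_eq_intros simp: power2_eq_square)
  then show ?thesis
    by (rule has_field_derivative_transform_within_open[of _ _ _ "{0<..}"])
      (use True in \<open>auto simp: smooth_step_def\<close>)
next
  case False
  have "((\<lambda>x. \<sigma> * exp (\<sigma> * x)) has_real_derivative \<sigma>\<^sup>2 * exp (- \<sigma> * \<bar>x\<bar>)) (at x)"
    using False by (auto intro!: derivative_eq_intros simp: power2_eq_square)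
  then show ?thesis
    by (rule has_field_derivative_transform_within_open[of _ _ _ "{..<0}"])
      (use False assms in \<open>auto simp: smooth_step_def\<close>)
qed

lemma integrable_indicator:
  assumes "A \<in> sets lebesgue" "A \<subseteq> {a..b}"
  shows "integrable lebesgue (\<lambda>t. indicat_real A t * h t)"
proof (rule integrable_kernel)
  show "\<bar>indicat_real A t\<bar> \<le> exp (\<sigma> * max \<bar>a\<bar> \<bar>b\<bar>) * exp (- \<sigma> * \<bar>t\<bar>)" for t
  proof (cases "t \<in> A")
    case True
    then have "\<bar>t\<bar> \<le> max \<bar>a\<bar> \<bar>b\<bar>"
      using assms(2) by fastforce
    then show ?thesis
      using True sigma_pos by (simp add: exp_add[symmetric])
  qed simp
qed (use assms in measurable)

lemma integrable_Ico: "integrable lebesgue (\<lambda>t. indicat_real {a..<b} t * h t)"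
  by (rule integrable_indicator[of _ a b]) auto

text \<open>The jump of \<open>kernel_conv'\<close> caused by the kink of the kernel is compensated by a multiple
  of an antiderivative of \<open>h\<close>.\<close>

definition compensated :: "real \<Rightarrow> real \<Rightarrow> real" where
  "compensated a s = kernel_conv' s + 2 * \<sigma> * (LINT t'|lebesgue. indicat_real {a..<s} t' * h t')"

text \<open>For a \<le> s the indicator of [a, s) is that of t' < s minus that of t' < a. The first
  moves with s and fills the jump; the second is independent of s and drops out of difference
  quotients. At t' = s itself the sides can differ.\<close>

lemma compensated_integrand:
  assumes "a \<le> s"
  shows "AE t' in lebesgue. - \<sigma> * sgn (s - t') * exp (- \<sigma> * \<bar>s - t'\<bar>) * h t' +
      2 * \<sigma> * (indicat_real {a..<s} t' * h t') =
      (smooth_step (s - t') - 2 * \<sigma> * indicat_real {..<a} t') * h t'"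
  using AE_neq[of s]
  by eventually_elim (use assms in \<open>auto simp: smooth_step_def indicator_def sgn_if algebra_simps\<close>)

lemma measurable_smooth_step [measurable]: "(\<lambda>t'. smooth_step (s - t')) \<in> borel_measurable lebesgue"
  unfolding smooth_step_def by (intro measurable_completion) measurable

lemma compensated_integrable:
  assumes "a \<le> s"
  shows "integrable lebesgue (\<lambda>t'. (smooth_step (s - t') - 2 * \<sigma> * indicat_real {..<a} t') * h t')"
proof (rule integrable_cong_AE_imp[OF _ _ compensated_integrand[OF assms]])
  show "integrable lebesgue (\<lambda>t'. - \<sigma> * sgn (s - t') * exp (- \<sigma> * \<bar>s - t'\<bar>) * h t' +
      2 * \<sigma> * (indicat_real {a..<s} t' * h t'))"
    by (intro Bochner_Integration.integrable_add integrable_mult_right integrable_exp_kernel' integrable_Ico)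
qed (intro borel_measurable_times borel_measurable_diff measurable_smooth_step measurable_h
      borel_measurable_const borel_measurable_indicator, simp)

lemma compensated_eq:
  assumes "a \<le> s"
  shows "compensated a s = (LINT t'|lebesgue. (smooth_step (s - t') - 2 * \<sigma> * indicat_real {..<a} t') * h t')"
proof -
  have "compensated a s = (LINT t'|lebesgue. - \<sigma> * sgn (s - t') * exp (- \<sigma> * \<bar>s - t'\<bar>) * h t' +
      2 * \<sigma> * (indicat_real {a..<s} t' * h t'))"
    unfolding compensated_def kernel_conv'_def
    using integrable_exp_kernel'[of s] integrable_Ico[of a s] by (subst Bochner_Integration.integral_add) auto
  also have "\<dots> = (LINT t'|lebesgue. (smooth_step (s - t') - 2 * \<sigma> * indicat_real {..<a} t') * h t')"
    by (rule integral_cong_AE[OF _ _ compensated_integrand[OF assms]])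
      (use integrable_exp_kernel'[of s] integrable_Ico[of a s] in \<open>auto intro!: borel_measurable_integrable compensated_integrable assms\<close>)
  finally show ?thesis .
qed

text \<open>\<open>smooth_step\<close> is Lipschitz, so this derivative exists at every t > a even
  where h is wild: all irregularity of \<open>kernel_conv'\<close> sits in the antiderivative of
  h.\<close>

lemma has_derivative_compensated:
  assumes "a < t"
  shows "(compensated a has_real_derivative \<sigma>\<^sup>2 * kernel_conv t) (at t)"
proof -
  define r where "r = min 1 (t - a)"
  have r: "r > 0" "\<And>s. dist s t < r \<Longrightarrow> a \<le> s" "\<And>s. dist s t < r \<Longrightarrow> \<bar>s - t\<bar> < 1"
    using assms by (auto simp: r_def dist_real_def)
  let ?f = "\<lambda>s t'. (smooth_step (s - t') - 2 * \<sigma> * indicat_real {..<a} t') * h t'"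
  have "((\<lambda>s. LINT t'|lebesgue. ?f s t') has_real_derivative
      (LINT t'|lebesgue. \<sigma>\<^sup>2 * (exp (- \<sigma> * \<bar>t - t'\<bar>) * h t'))) (at t)"
  proof (rule has_field_derivative_integral[where r = r and
        B = "\<lambda>t'. \<sigma>\<^sup>2 * exp \<sigma> * \<bar>exp (- \<sigma> * \<bar>t - t'\<bar>) * h t'\<bar>"])
    show "AE t' in lebesgue. ((\<lambda>s. ?f s t') has_real_derivative
        \<sigma>\<^sup>2 * (exp (- \<sigma> * \<bar>t - t'\<bar>) * h t')) (at t)"
      using AE_neq[of t]
    proof eventually_elim
      case (elim t')
      have "((\<lambda>s. smooth_step (s - t')) has_real_derivative \<sigma>\<^sup>2 * exp (- \<sigma> * \<bar>t - t'\<bar>)) (at t)"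
        using has_derivative_smooth_step[of "t - t'"] elim DERIV_shift[of smooth_step _ t "- t'"] by simp
      then show ?case
        by (auto intro!: derivative_eq_intros)
    qed
    show "(\<lambda>t'. \<sigma>\<^sup>2 * (exp (- \<sigma> * \<bar>t - t'\<bar>) * h t')) \<in> borel_measurable lebesgue"
      by (intro borel_measurable_times borel_measurable_const borel_measurable_integrable[OF integrable_exp_kernel])
    show "integrable lebesgue (\<lambda>t'. \<sigma>\<^sup>2 * exp \<sigma> * \<bar>exp (- \<sigma> * \<bar>t - t'\<bar>) * h t'\<bar>)"
      by (intro integrable_mult_right integrable_abs integrable_exp_kernel)
  next
    fix s :: real assume s: "dist s t < r"
    show "integrable lebesgue (?f s)"
      using r(2)[OF s] by (rule compensated_integrable)
    have "\<bar>smooth_step (s - t') - smooth_step (t - t')\<bar> * \<bar>h t'\<bar> \<le>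
        (\<sigma>\<^sup>2 * \<bar>s - t\<bar> * exp (\<sigma> - \<sigma> * \<bar>t - t'\<bar>)) * \<bar>h t'\<bar>" for t'
      using smooth_step_diff_le[of "s - t'" "t - t'"] r(3)[OF s] by (intro mult_right_mono) auto
    moreover have "\<bar>?f s t' - ?f t t'\<bar> = \<bar>smooth_step (s - t') - smooth_step (t - t')\<bar> * \<bar>h t'\<bar>" for t'
      by (simp add: abs_mult[symmetric] algebra_simps)
    ultimately show "AE t' in lebesgue. norm (?f s t' - ?f t t')
        \<le> \<sigma>\<^sup>2 * exp \<sigma> * \<bar>exp (- \<sigma> * \<bar>t - t'\<bar>) * h t'\<bar> * norm (s - t)"
      by (simp add: abs_mult exp_diff exp_minus field_simps)
  qed (use r in auto)
  then have "((\<lambda>s. LINT t'|lebesgue. ?f s t') has_real_derivative \<sigma>\<^sup>2 * kernel_conv t) (at t)"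
    by (simp add: kernel_conv_def)
  then show ?thesis
    by (rule has_field_derivative_transform_within_open[of _ _ _ "{a<..}"])
      (use assms in \<open>auto simp: compensated_eq\<close>)
qed

lemma absolutely_integrable_h: "h absolutely_integrable_on {a..b}"
  using integrable_indicator[of "{a..b}" a b] by (simp add: set_integrable_def)

lemma integral_indicator_atLeastLessThan:
  "(LINT t'|lebesgue. indicat_real {a..<s} t' * h t') = integral {a..s} h"
proof -
  have "(LINT t'|lebesgue. indicat_real {a..<s} t' * h t') = (LINT t'|lebesgue. indicat_real {a..s} t' * h t')"
  proof (rule integral_cong_AE)
    show "AE t' in lebesgue. indicat_real {a..<s} t' * h t' = indicat_real {a..s} t' * h t'"
      using AE_neq[of s] by eventually_elim (auto simp: indicator_def)
  qed (auto intro!: borel_measurable_integrable integrable_indicator[of _ a s])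
  also have "\<dots> = integral {a..s} h"
    using set_lebesgue_integral_eq_integral(2)[OF absolutely_integrable_h[of a s]]
    by (simp add: set_lebesgue_integral_def)
  finally show ?thesis .
qed

lemma continuous_kernel_conv: "continuous_on S kernel_conv"
  by (intro continuous_at_imp_continuous_on ballI DERIV_isCont[OF has_derivative_kernel_conv])

lemma kernel_conv''_has_integral:
  assumes "a \<le> b"
  shows "((\<lambda>t. \<sigma>\<^sup>2 * kernel_conv t - 2 * \<sigma> * h t) has_integral kernel_conv' b - kernel_conv' a) {a..b}"
proof -
  \<comment> \<open>The base point a - 1 lies strictly to the left of the interval, so the
    derivative is available at its left end too.\<close>
  have "((\<lambda>t. \<sigma>\<^sup>2 * kernel_conv t) has_integral compensated (a - 1) b - compensated (a - 1) a) {a..b}"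
    using assms
    by (intro fundamental_theorem_of_calculus)
       (auto simp: has_real_derivative_iff_has_vector_derivative[symmetric]
         intro!: has_field_derivative_at_within[OF has_derivative_compensated])
  moreover have hi: "h integrable_on {c..d}" for c d
    using absolutely_integrable_h by (simp add: absolutely_integrable_on_def)
  then have "((\<lambda>t. 2 * \<sigma> * h t) has_integral 2 * \<sigma> * integral {a..b} h) {a..b}"
    by (intro has_integral_mult_right integrable_integral)
  ultimately have "((\<lambda>t. \<sigma>\<^sup>2 * kernel_conv t - 2 * \<sigma> * h t) has_integral
      compensated (a - 1) b - compensated (a - 1) a - 2 * \<sigma> * integral {a..b} h) {a..b}"
    by (rule has_integral_diff)
  then have "((\<lambda>t. \<sigma>\<^sup>2 * kernel_conv t - 2 * \<sigma> * h t) has_integral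
      kernel_conv' b + 2 * \<sigma> * integral {a - 1..b} h - (kernel_conv' a + 2 * \<sigma> * integral {a - 1..a} h) -
      2 * \<sigma> * integral {a..b} h) {a..b}"
    by (simp only: compensated_def integral_indicator_atLeastLessThan)
  moreover have "integral {a - 1..b} h = integral {a - 1..a} h + integral {a..b} h"
    using Henstock_Kurzweil_Integration.integral_combine[of "a - 1" a b h] hi assms by simp
  ultimately show ?thesis
    by (simp add: algebra_simps)
qed

lemma has_derivative_kernel_conv':
  assumes "isCont h t"
  shows "(kernel_conv' has_real_derivative \<sigma>\<^sup>2 * kernel_conv t - 2 * \<sigma> * h t) (at t)"
proof -
  have "((\<lambda>s. integral {t - 1..s} h) has_vector_derivative h t) (at t within {t - 1..t + 1})"
    using absolutely_integrable_h[of "t - 1" "t + 1"] assms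
      integral_has_vector_derivative_continuous_at[of h "t - 1" "t + 1" t "{}"]
    by (simp add: absolutely_integrable_on_def continuous_at_imp_continuous_at_within)
  moreover have "at t within {t - 1..t + 1} = at t"
    by (rule at_within_interior) simp
  ultimately have i: "((\<lambda>s. integral {t - 1..s} h) has_real_derivative h t) (at t)"
    by (simp only: has_real_derivative_iff_has_vector_derivative)
  have "(compensated (t - 1) has_real_derivative \<sigma>\<^sup>2 * kernel_conv t) (at t)"
    by (rule has_derivative_compensated) simp
  from DERIV_diff[OF this DERIV_cmult[OF i, of "2 * \<sigma>"]] show ?thesis
    by (simp only: compensated_def integral_indicator_atLeastLessThan add_diff_cancel_right')
qed

lemma solves_ode_kernel_conv: "solves_ode (of_real \<sigma>) h (\<lambda>t. of_real (kernel_conv t))"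
proof -
  let ?W'' = "\<lambda>t. \<sigma>\<^sup>2 * kernel_conv t - 2 * \<sigma> * h t"
  have abs: "(\<lambda>t. complex_of_real (?W'' t)) absolutely_integrable_on {a..b}" for a b
  proof -
    have "?W'' absolutely_integrable_on {a..b}"
      using absolutely_integrable_continuous_real[OF continuous_kernel_conv[of "{a..b}"]] absolutely_integrable_h[of a b]
      by (intro set_integral_diff set_integrable_mult_right) auto
    then show ?thesis
      by (rule absolutely_integrable_linear[OF _ bounded_linear_of_real, unfolded o_def])
  qed
  show ?thesis
    unfolding solves_ode_def
  proof (rule exI[of _ "\<lambda>t. of_real (kernel_conv' t)"], rule exI[of _ "\<lambda>t. of_real (?W'' t)"], intro conjI allI impI)
    show "((\<lambda>t. complex_of_real (kernel_conv t)) has_vector_derivative of_real (kernel_conv' t)) (at t)" for t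
      using has_derivative_kernel_conv[of t] by (intro has_vector_derivative_of_real)
    show "((\<lambda>t. complex_of_real (kernel_conv' t)) has_vector_derivative of_real (?W'' t)) (at t)"
      if "isCont h t" for t
      using has_derivative_kernel_conv'[OF that] by (intro has_vector_derivative_of_real)
    show "((\<lambda>t. complex_of_real (?W'' t)) has_integral of_real (kernel_conv' b) - of_real (kernel_conv' a)) {a..b}"
      if "a \<le> b" for a b
      using has_integral_linear[OF kernel_conv''_has_integral[OF that] bounded_linear_of_real]
      by (simp add: o_def)
    show "- (1 / complex_of_real \<sigma>) * of_real (?W'' t) + of_real \<sigma> * of_real (kernel_conv t) = 2 * of_real (h t)" for t
      using sigma_pos by (simp add: field_simps power2_eq_square)
  qed (rule abs)
qed

end

subsection \<open>Signs of the coefficients of an exponential series\<close>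

lemma has_bochner_integral_exp_half_line:
  fixes a :: complex
  assumes a: "Re a > 0"
  shows "has_bochner_integral lborel (\<lambda>t. indicator {x0<..} t *\<^sub>R exp (- a * of_real t))
    (exp (- a * of_real x0) / a)"
proof -
  have a0: "a \<noteq> 0"
    using a by auto
  have "(\<lambda>t::real. exp (- Re a * t)) absolutely_integrable_on {x0..}"
    using has_integral_exp_minus_to_infinity[OF a, of x0]
    by (intro nonnegative_absolutely_integrable_1) auto
  then have "set_integrable lborel {x0..} (\<lambda>t. exp (- Re a * t))"
    by (simp add: set_integrable_def integrable_completion)
  then have *: "integrable lborel (\<lambda>t. indicator {x0..} t *\<^sub>R exp (- Re a * t))"
    by (simp add: set_integrable_def)
  have int: "set_integrable lborel {x0<..} (\<lambda>t. exp (- a * of_real t))"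
    unfolding set_integrable_def
    by (rule Bochner_Integration.integrable_bound[OF *]) (auto simp: indicator_def)
  have "(LBINT t=ereal x0..\<infinity>. exp (- a * of_real t)) = 0 - (- exp (- a * of_real x0) / a)"
  proof (rule interval_integral_FTC_integrable)
    show "((\<lambda>t. - exp (- a * of_real t) / a) has_vector_derivative exp (- a * of_real t)) (at t)" for t
      using a0 by (auto intro!: derivative_eq_intros has_vector_derivative_real_field)
    show "(((\<lambda>t. - exp (- a * of_real t) / a) \<circ> real_of_ereal) \<longlongrightarrow> - exp (- a * of_real x0) / a) (at_right (ereal x0))"
      unfolding ereal_tendsto_simps using a0 by (auto intro!: tendsto_eq_intros)
    have "((\<lambda>t. exp (- Re a * t)) \<longlongrightarrow> 0) at_top"
      using a by (intro filterlim_compose[OF exp_at_bot]) real_asymp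
    then have "((\<lambda>t. exp (- a * of_real t)) \<longlongrightarrow> 0) at_top"
      by (subst tendsto_norm_zero_iff[symmetric]) simp
    then show "(((\<lambda>t. - exp (- a * of_real t) / a) \<circ> real_of_ereal) \<longlongrightarrow> 0) (at_left \<infinity>)"
      unfolding ereal_tendsto_simps
      using tendsto_divide[OF tendsto_minus tendsto_const, of _ 0 at_top a] a0 by simp
  qed (use int in \<open>auto intro!: continuous_intros\<close>)
  then show ?thesis
    using int
    by (simp add: interval_lebesgue_integral_def set_lebesgue_integral_def set_integrable_def has_bochner_integral_iff)
qed

text \<open>The Fourier transform of exp(-\<sigma>\<bar>t\<bar>) cut off to \<bar>t\<bar> > x0,
  written so that it makes sense for complex z. For x0 = 0 it is the partial fraction
  2\<sigma>/(\<sigma>^2 + z^2), with poles at i\<sigma> and -i\<sigma>.\<close>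

definition two_sided_exp :: "real \<Rightarrow> real \<Rightarrow> complex \<Rightarrow> complex" where
  "two_sided_exp \<sigma> x0 z = exp (- (of_real \<sigma> + \<i> * z) * of_real x0) / (of_real \<sigma> + \<i> * z) +
     exp (- (of_real \<sigma> - \<i> * z) * of_real x0) / (of_real \<sigma> - \<i> * z)"

lemma has_bochner_integral_two_sided_exp:
  assumes "\<sigma> > 0" "x0 \<ge> 0"
  shows "has_bochner_integral lborel
    (\<lambda>t. exp (- (\<i> * of_real (\<xi> * t))) * of_real (indicator {t. \<bar>t\<bar> > x0} t * exp (- \<sigma> * \<bar>t\<bar>)))
    (two_sided_exp \<sigma> x0 (of_real \<xi>))"
proof -
  let ?f = "\<lambda>a t. indicator {x0<..} t *\<^sub>R exp (- a * complex_of_real t)"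
  have "has_bochner_integral lborel (?f (of_real \<sigma> + \<i> * of_real \<xi>))
      (exp (- (of_real \<sigma> + \<i> * of_real \<xi>) * of_real x0) / (of_real \<sigma> + \<i> * of_real \<xi>))"
    by (rule has_bochner_integral_exp_half_line) (use assms in simp)
  moreover have "has_bochner_integral lborel (?f (of_real \<sigma> - \<i> * of_real \<xi>))
      (exp (- (of_real \<sigma> - \<i> * of_real \<xi>) * of_real x0) / (of_real \<sigma> - \<i> * of_real \<xi>))"
    by (rule has_bochner_integral_exp_half_line) (use assms in simp)
  then have "has_bochner_integral lborel (\<lambda>t. ?f (of_real \<sigma> - \<i> * of_real \<xi>) (0 + (-1) * t))
      (exp (- (of_real \<sigma> - \<i> * of_real \<xi>) * of_real x0) / (of_real \<sigma> - \<i> * of_real \<xi>))"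
    by (subst (asm) lborel_has_bochner_integral_real_affine_iff[where c = "-1" and t = 0]) auto
  ultimately have "has_bochner_integral lborel
      (\<lambda>t. ?f (of_real \<sigma> + \<i> * of_real \<xi>) t + ?f (of_real \<sigma> - \<i> * of_real \<xi>) (0 + (-1) * t))
      (two_sided_exp \<sigma> x0 (of_real \<xi>))"
    unfolding two_sided_exp_def by (rule has_bochner_integral_add)
  moreover have "?f (of_real \<sigma> + \<i> * of_real \<xi>) t + ?f (of_real \<sigma> - \<i> * of_real \<xi>) (0 + (-1) * t) =
      exp (- (\<i> * of_real (\<xi> * t))) * of_real (indicator {t. \<bar>t\<bar> > x0} t * exp (- \<sigma> * \<bar>t\<bar>))" for t
  proof -
    consider "t > x0" | "t < - x0" | "\<bar>t\<bar> \<le> x0"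
      by linarith
    then show ?thesis
      using assms(2) by cases
        (auto simp: exp_of_real[symmetric] exp_add[symmetric] algebra_simps)
  qed
  ultimately show ?thesis
    by (simp only:)
qed

text \<open>The denominators are bounded below by their imaginary parts, which are Re z up to sign,
  rather than through \<sigma>. Off the imaginary axis \<sigma> then enters only through
  exp(-\<sigma> x0), the gain from cutting at x0.\<close>

lemma norm_two_sided_exp_le:
  assumes "\<sigma> > 0" "x0 \<ge> 0" "\<rho> > 0" "\<bar>Re z\<bar> \<ge> \<rho>"
  shows "norm (two_sided_exp \<sigma> x0 z) \<le> 2 * exp (- \<sigma> * x0) * exp (norm z * x0) / \<rho>"
proof -
  have "norm (exp (- (of_real \<sigma> + w) * of_real x0) / (of_real \<sigma> + w)) \<le> exp (- \<sigma> * x0) * exp (norm z * x0) / \<rho>"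
    if w: "norm w = norm z" "\<bar>Im w\<bar> \<ge> \<rho>" for w
  proof -
    have "norm (exp (- (of_real \<sigma> + w) * of_real x0)) \<le> exp (- \<sigma> * x0 + norm z * x0)"
      using assms abs_Re_le_cmod[of w] mult_right_mono[of "- Re w" "norm z" x0] w
      by (auto simp: algebra_simps)
    moreover have "norm (of_real \<sigma> + w) \<ge> \<rho>"
      using abs_Im_le_cmod[of "of_real \<sigma> + w"] w by simp
    ultimately show ?thesis
      unfolding norm_divide exp_add[symmetric] using assms by (intro frac_le) auto
  qed
  from this[of "\<i> * z"] this[of "- (\<i> * z)"] assms
  have "norm (exp (- (of_real \<sigma> + \<i> * z) * of_real x0) / (of_real \<sigma> + \<i> * z)) \<le> exp (- \<sigma> * x0) * exp (norm z * x0) / \<rho>"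
    "norm (exp (- (of_real \<sigma> - \<i> * z) * of_real x0) / (of_real \<sigma> - \<i> * z)) \<le> exp (- \<sigma> * x0) * exp (norm z * x0) / \<rho>"
    by (auto simp: norm_mult)
  then show ?thesis
    unfolding two_sided_exp_def by (intro order_trans[OF norm_triangle_ineq]) (simp add: field_simps)
qed

lemma holomorphic_two_sided_exp: "two_sided_exp \<sigma> x0 holomorphic_on {z. Re z > 0}"
proof -
  have "of_real \<sigma> + \<i> * z \<noteq> 0" "of_real \<sigma> - \<i> * z \<noteq> 0" if "Re z > 0" for z
    using that by (auto simp: complex_eq_iff)
  then show ?thesis
    unfolding two_sided_exp_def[abs_def] by (intro holomorphic_intros) auto
qed

lemma holomorphic_suminf_two_sided_exp:
  fixes c \<sigma> :: "nat \<Rightarrow> real"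
  assumes pos: "\<And>j. \<sigma> j > 0" and "x0 \<ge> 0" and sum: "summable (\<lambda>j. \<bar>c j\<bar> * exp (- \<sigma> j * x0))"
  shows "(\<lambda>z. \<Sum>j. of_real (c j) * two_sided_exp (\<sigma> j) x0 z) holomorphic_on {z. Re z > 0}"
    and "Re z > 0 \<Longrightarrow> summable (\<lambda>j. of_real (c j) * two_sided_exp (\<sigma> j) x0 z)"
proof -
  let ?S = "{z. Re z > 0}"
  let ?f = "\<lambda>j z. of_real (c j) * two_sided_exp (\<sigma> j) x0 z"
  have S: "open ?S"
    by (rule open_halfspace_Re_gt)
  obtain g where g: "\<forall>z\<in>?S. (\<lambda>j. ?f j z) sums g z \<and> g field_differentiable (at z)"
  proof (rule series_differentiable_comparison_complex[OF S])
    show "?f j field_differentiable at z" if "z \<in> ?S" for j z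
      using holomorphic_two_sided_exp[of "\<sigma> j" x0] that S
      by (intro field_differentiable_mult field_differentiable_const) (simp add: holomorphic_on_imp_differentiable_at)
    fix z assume z: "z \<in> ?S"
    \<comment> \<open>Half the distance to the imaginary axis, so that Re y stays at least \<rho> on
      the ball and the majorant is uniform there.\<close>
    define \<rho> where "\<rho> = Re z / 2"
    define K where "K = 2 * exp ((norm z + \<rho>) * x0) / \<rho>"
    have \<rho>: "\<rho> > 0"
      using z by (simp add: \<rho>_def)
    have "norm (?f j y) \<le> \<bar>c j\<bar> * exp (- \<sigma> j * x0) * K" if y: "y \<in> ball z \<rho>" for j y
    proof -
      have n: "norm (z - y) < \<rho>"
        using y by (simp add: dist_norm)
      then have "\<bar>Re y\<bar> \<ge> \<rho>"
        using abs_Re_le_cmod[of "z - y"] by (simp add: \<rho>_def)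
      then have "norm (two_sided_exp (\<sigma> j) x0 y) \<le> 2 * exp (- \<sigma> j * x0) * exp (norm y * x0) / \<rho>"
        using pos[of j] assms \<rho> by (intro norm_two_sided_exp_le) auto
      also have "\<dots> \<le> 2 * exp (- \<sigma> j * x0) * exp ((norm z + \<rho>) * x0) / \<rho>"
      proof -
        have "norm y \<le> norm z + \<rho>"
          using n norm_triangle_ineq2[of y z] by (simp add: norm_minus_commute)
        then show ?thesis
          using \<rho> assms by (intro divide_right_mono mult_left_mono) (auto intro: mult_right_mono)
      qed
      finally have "\<bar>c j\<bar> * norm (two_sided_exp (\<sigma> j) x0 y) \<le> \<bar>c j\<bar> * (exp (- \<sigma> j * x0) * K)"
        by (intro mult_left_mono) (simp_all add: K_def ac_simps)
      then show ?thesis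
        by (simp add: norm_mult mult.assoc)
    qed
    moreover have "K \<ge> 0"
      using \<rho> by (simp add: K_def)
    ultimately show "\<exists>d h. 0 < d \<and> summable h \<and> range h \<subseteq> \<real>\<^sub>\<ge>\<^sub>0 \<and>
        (\<forall>\<^sub>F j in sequentially. \<forall>y\<in>ball z d \<inter> ?S. cmod (?f j y) \<le> cmod (h j))"
      using \<rho> summable_mult2[OF sum, of K]
      by (intro exI[of _ \<rho>] exI[of _ "\<lambda>j. complex_of_real (\<bar>c j\<bar> * exp (- \<sigma> j * x0) * K)"])
         (auto simp: norm_mult simp del: of_real_mult)
  qed
  then have "suminf (\<lambda>j. ?f j z) = g z" if "z \<in> ?S" for z
    using that sums_unique by fastforce
  moreover have "g holomorphic_on ?S"
    using g S by (simp add: holomorphic_on_open field_differentiable_def)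
  ultimately show "(\<lambda>z. \<Sum>j. ?f j z) holomorphic_on ?S"
    by (subst holomorphic_cong[OF refl, of _ _ g]) auto
  show "summable (\<lambda>j. ?f j z)" if "Re z > 0"
    using g that by (auto simp: sums_iff)
qed

text \<open>On a bounded interval the exponential is at most exp(\<bar>z\<bar> x0), so integrability
  of G alone makes the transform entire, whatever its singularity at the origin.\<close>

lemma holomorphic_near_part:
  fixes G :: "real \<Rightarrow> real"
  assumes G: "integrable lborel G"
  shows "(\<lambda>z. LINT t|lborel. exp (- (\<i> * z * of_real t)) * of_real (indicator {-x0..x0} t * G t)) holomorphic_on UNIV"
proof -
  let ?g = "\<lambda>t. complex_of_real (indicator {-x0..x0} t * G t)"
  let ?f = "\<lambda>z t. exp (- (\<i> * z * of_real t)) * ?g t"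
  have g: "integrable lborel ?g"
    using integrable_mult_indicator[OF _ G, of "{-x0..x0}"] by (intro integrable_of_real) simp
  have bound: "norm (exp (- (\<i> * z * of_real t))) \<le> exp ((norm z) * x0)" if "\<bar>t\<bar> \<le> x0" for z t
  proof -
    have "Im z * t \<le> \<bar>Im z\<bar> * \<bar>t\<bar>"
      by (metis abs_ge_self abs_mult)
    also have "\<dots> \<le> norm z * x0"
      using that abs_Im_le_cmod[of z] by (intro mult_mono) auto
    finally show ?thesis
      by simp
  qed
  have meas [measurable]: "?g \<in> borel_measurable borel"
    using g by (simp add: borel_measurable_integrable)
  have int: "integrable lborel (?f z)" for z
  proof (rule Bochner_Integration.integrable_bound)
    show "integrable lborel (\<lambda>t. exp (norm z * x0) * norm (?g t))"
      by (intro integrable_mult_right integrable_norm g)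
    show "?f z \<in> borel_measurable lborel"
      by measurable
    show "AE t in lborel. norm (?f z t) \<le> norm (exp (norm z * x0) * norm (?g t))"
      using bound[of _ z] by (intro AE_I2) (auto simp: norm_mult indicator_def mult_right_mono)
  qed
  have "((\<lambda>z. LINT t|lborel. ?f z t) has_field_derivative
      (LINT t|lborel. - \<i> * of_real t * ?f z t)) (at z)" for z
  proof (rule has_field_derivative_integral[where r = 1 and
        B = "\<lambda>t. x0 * exp ((norm z + 1) * x0) * norm (?g t)"])
    show "AE t in lborel. ((\<lambda>z. ?f z t) has_field_derivative - \<i> * of_real t * ?f z t) (at z)"
      by (intro AE_I2) (auto intro!: derivative_eq_intros)
    show "integrable lborel (\<lambda>t. x0 * exp ((norm z + 1) * x0) * norm (?g t))"
      by (intro integrable_mult_right integrable_norm g)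
  next
    fix s assume s: "dist s z < 1"
    have "norm (exp (- (\<i> * s * of_real t)) - exp (- (\<i> * z * of_real t))) \<le>
        x0 * exp ((norm z + 1) * x0) * norm (s - z)" if t: "\<bar>t\<bar> \<le> x0" for t
    proof (rule field_differentiable_bound[where S = "ball z 1"])
      fix y assume y: "y \<in> ball z 1"
      show "((\<lambda>s. exp (- (\<i> * s * of_real t))) has_field_derivative
          - \<i> * of_real t * exp (- (\<i> * y * of_real t))) (at y within ball z 1)"
        by (auto intro!: derivative_eq_intros)
      have "norm y \<le> norm z + 1"
        using y norm_triangle_ineq2[of y z] by (simp add: dist_norm norm_minus_commute)
      then have "exp (norm y * x0) \<le> exp ((norm z + 1) * x0)"
        using t by (auto intro!: mult_right_mono)
      then show "norm (- \<i> * of_real t * exp (- (\<i> * y * of_real t))) \<le> x0 * exp ((norm z + 1) * x0)"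
        unfolding norm_mult using bound[OF t, of y] t by (intro mult_mono) (auto simp: norm_mult)
    qed (use s in \<open>auto simp: dist_commute\<close>)
    note diff_le = this
    have "norm (?f s t - ?f z t) \<le> x0 * exp ((norm z + 1) * x0) * norm (?g t) * norm (s - z)" for t
    proof (cases "\<bar>t\<bar> \<le> x0")
      case True
      have "norm (?f s t - ?f z t) = norm (exp (- (\<i> * s * of_real t)) - exp (- (\<i> * z * of_real t))) * norm (?g t)"
        by (simp only: left_diff_distrib[symmetric] norm_mult)
      also have "\<dots> \<le> (x0 * exp ((norm z + 1) * x0) * norm (s - z)) * norm (?g t)"
        by (intro mult_right_mono diff_le True norm_ge_zero)
      finally show ?thesis
        by (simp only: ac_simps)
    qed (auto simp: indicator_def)
    then show "AE t in lborel. norm (?f s t - ?f z t) \<le> x0 * exp ((norm z + 1) * x0) * norm (?g t) * norm (s - z)"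
      by (rule AE_I2)
  qed (use int in auto)
  then show ?thesis
    by (auto simp: holomorphic_on_open)
qed

text \<open>On \<bar>t\<bar> > x0 the sum and the integral may be exchanged: the terms have L1 norms
  \<bar>c j\<bar> exp(-\<sigma> j x0) 2/\<sigma> j, which are summable since the rates stay above
  s0.\<close>

lemma integral_exp_series_split:
  fixes G :: "real \<Rightarrow> real" and c \<sigma> :: "nat \<Rightarrow> real"
  assumes G: "integrable lborel G" and x0: "x0 > 0"
    and pos: "\<And>j. \<sigma> j \<ge> s0" "s0 > 0"
    and sums: "\<And>t. t \<noteq> 0 \<Longrightarrow> (\<lambda>j. c j * exp (- \<sigma> j * \<bar>t\<bar>)) sums G t"
    and abs: "\<And>x. x > 0 \<Longrightarrow> summable (\<lambda>j. \<bar>c j\<bar> * exp (- \<sigma> j * x))"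
  shows "(LINT t|lborel. exp (- (\<i> * of_real (\<xi> * t))) * of_real (G t)) =
    (LINT t|lborel. exp (- (\<i> * of_real \<xi> * of_real t)) * of_real (indicator {-x0..x0} t * G t)) +
    (\<Sum>j. of_real (c j) * two_sided_exp (\<sigma> j) x0 (of_real \<xi>))"
proof -
  let ?I = "\<lambda>t. indicat_real {t. \<bar>t\<bar> > x0} t"
  let ?e = "\<lambda>t. exp (- (\<i> * of_real (\<xi> * t)))"
  let ?f = "\<lambda>j t. of_real (c j) * (?e t * of_real (?I t * exp (- \<sigma> j * \<bar>t\<bar>)))"
  have spos: "\<sigma> j > 0" for j
    using pos(1)[of j] pos(2) by linarith
  have ih: "integrable lborel (\<lambda>t. ?e t * of_real (?I t * exp (- \<sigma> j * \<bar>t\<bar>)))"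
    "(LINT t|lborel. ?e t * of_real (?I t * exp (- \<sigma> j * \<bar>t\<bar>))) = two_sided_exp (\<sigma> j) x0 (of_real \<xi>)" for j
    using has_bochner_integral_two_sided_exp[OF spos[of j] less_imp_le[OF x0], of \<xi>]
    by (auto simp: has_bochner_integral_iff)
  have norm_f: "norm (?f j t) = \<bar>c j\<bar> * (?I t * exp (- \<sigma> j * \<bar>t\<bar>))" for j t
    by (simp add: norm_mult)
  have int_f: "integrable lborel (?f j)" for j
    by (intro integrable_mult_right ih)
  have "(LINT t|lborel. ?I t * exp (- \<sigma> j * \<bar>t\<bar>)) = 2 * exp (- \<sigma> j * x0) / \<sigma> j" for j
  proof -
    \<comment> \<open>The L1 norm of the cut-off exponential is its Fourier transform at frequency
      0.\<close>
    have "complex_of_real (LINT t|lborel. ?I t * exp (- \<sigma> j * \<bar>t\<bar>)) = two_sided_exp (\<sigma> j) x0 0"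
      using has_bochner_integral_two_sided_exp[OF spos[of j] less_imp_le[OF x0], of 0]
      by (simp add: has_bochner_integral_iff del: of_real_mult)
    also have "\<dots> = complex_of_real (2 * exp (- \<sigma> j * x0) / \<sigma> j)"
      by (simp add: two_sided_exp_def exp_of_real[symmetric])
    finally show ?thesis
      by (simp only: of_real_eq_iff)
  qed
  then have norm_int: "(LINT t|lborel. norm (?f j t)) = \<bar>c j\<bar> * exp (- \<sigma> j * x0) * (2 / \<sigma> j)" for j
    unfolding norm_f by simp
  have summable_norm: "summable (\<lambda>j. norm (?f j t))" for t
    unfolding norm_f using abs[of "\<bar>t\<bar>"] x0 by (cases "\<bar>t\<bar> > x0") auto
  have "summable (\<lambda>j. LINT t|lborel. norm (?f j t))"
    unfolding norm_int
  proof (rule summable_comparison_test'[OF summable_mult2[OF abs[OF x0], of "2 / s0"]])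
    show "norm (\<bar>c j\<bar> * exp (- \<sigma> j * x0) * (2 / \<sigma> j)) \<le> \<bar>c j\<bar> * exp (- \<sigma> j * x0) * (2 / s0)" for j
      using pos(1)[of j] pos(2) spos[of j] by (auto simp: abs_mult intro!: mult_left_mono frac_le)
  qed
  then have far: "integrable lborel (\<lambda>t. \<Sum>j. ?f j t)"
    "(LINT t|lborel. (\<Sum>j. ?f j t)) = (\<Sum>j. LINT t|lborel. ?f j t)"
    using integrable_suminf[OF int_f] integral_suminf[OF int_f] summable_norm by auto
  have near: "integrable lborel (\<lambda>t. ?e t * of_real (indicator {-x0..x0} t * G t))"
  proof (rule Bochner_Integration.integrable_bound[OF G])
    have [measurable]: "G \<in> borel_measurable borel"
      using borel_measurable_integrable[OF G] by simp
    show "(\<lambda>t. ?e t * of_real (indicator {-x0..x0} t * G t)) \<in> borel_measurable lborel"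
      by measurable
  qed (auto simp: norm_mult indicator_def)
  have "?e t * of_real (G t) = ?e t * of_real (indicator {-x0..x0} t * G t) + (\<Sum>j. ?f j t)" for t
  proof (cases "\<bar>t\<bar> > x0")
    case True
    then have "(\<lambda>j. ?e t * complex_of_real (c j * exp (- \<sigma> j * \<bar>t\<bar>))) sums (?e t * of_real (G t))"
      using x0 by (intro sums_mult sums_of_real sums) auto
    then have "(\<Sum>j. ?f j t) = ?e t * of_real (G t)"
      using True by (simp add: sums_iff ac_simps)
    then show ?thesis
      using True by (auto simp: indicator_def)
  qed (auto simp: indicator_def)
  then have "(LINT t|lborel. ?e t * of_real (G t)) =
      (LINT t|lborel. ?e t * of_real (indicator {-x0..x0} t * G t)) + (LINT t|lborel. (\<Sum>j. ?f j t))"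
    by (simp only: Bochner_Integration.integral_add[OF near far(1)])
  also have "(LINT t|lborel. (\<Sum>j. ?f j t)) = (\<Sum>j. of_real (c j) * two_sided_exp (\<sigma> j) x0 (of_real \<xi>))"
    unfolding far(2) using ih by simp
  finally show ?thesis
    by (simp add: mult.assoc)
qed

text \<open>Splitting off the part of the Fourier integral near the origin, where \<open>G\<close> may be singular,
  continues \<open>1 / (T - \<kappa>)\<close> as an absolutely convergent series of partial fractions. Its imaginary
  part is negative in the open quadrant, while next to the pole \<open>\<i> * \<sigma> j\<close> it is about \<open>- c j / x\<close>.\<close>

lemma exp_series_coeff_nonneg:
  fixes G :: "real \<Rightarrow> real" and c \<sigma> :: "nat \<Rightarrow> real"
  assumes G: "integrable lborel G"
    and pos: "\<And>j. \<sigma> j \<ge> s0" "s0 > 0" and inj: "inj \<sigma>"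
    and sums: "\<And>t. t \<noteq> 0 \<Longrightarrow> (\<lambda>j. c j * exp (- \<sigma> j * \<bar>t\<bar>)) sums G t"
    and abs: "\<And>x. x > 0 \<Longrightarrow> summable (\<lambda>j. \<bar>c j\<bar> * exp (- \<sigma> j * x))"
    and T: "T holomorphic_on {z. Re z > 0}"
    and Im_T: "\<And>z. Re z > 0 \<Longrightarrow> Im z > 0 \<Longrightarrow> Im (T z) > 0"
    and fourier: "\<And>\<xi>. 0 < \<xi> \<Longrightarrow> (T (of_real \<xi>) - of_real \<kappa>) *
       (LINT t|lborel. exp (- (\<i> * of_real (\<xi> * t))) * of_real (G t)) = 1"
  shows "c j \<ge> 0"
proof -
  define N where "N z = (LINT t|lborel. exp (- (\<i> * z * of_real t)) * of_real (indicator {-1..1} t * G t))" for z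
  define S where "S z = (\<Sum>k. of_real (c k) * two_sided_exp (\<sigma> k) 1 z)" for z
  let ?H = "{z::complex. Re z > 0}"
  have spos: "\<sigma> k > 0" for k
    using pos(1)[of k] pos(2) by linarith
  have N: "N holomorphic_on A" for A
    using holomorphic_near_part[OF G, of 1] by (auto simp: N_def[abs_def] intro: holomorphic_on_subset)
  have S: "S holomorphic_on ?H"
    unfolding S_def[abs_def] using spos abs[of 1] by (intro holomorphic_suminf_two_sided_exp) auto
  \<comment> \<open>The Fourier identity holds on the positive real axis and both sides are
    holomorphic in the right half plane. The product form avoids dividing before T - \<kappa> is
    known to be nonzero.\<close>
  have id: "(T z - of_real \<kappa>) * (N z + S z) - 1 = 0" if "Re z > 0" for z
  proof (rule analytic_continuation[where f = "\<lambda>z. (T z - of_real \<kappa>) * (N z + S z) - 1" and S = ?H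
        and U = "of_real ` {0<..<1}" and \<xi> = "1 / 2"])
    show "(\<lambda>z. (T z - of_real \<kappa>) * (N z + S z) - 1) holomorphic_on ?H"
      by (intro holomorphic_intros T N S)
    show "open ?H"
      by (rule open_halfspace_Re_gt)
    show "connected ?H"
      by (intro convex_connected convex_halfspace_Re_gt)
    show "1 / 2 islimpt complex_of_real ` {0<..<1}"
    proof -
      have "(1 / 2 :: real) islimpt {0<..<1}"
        by (rule interior_limit_point) simp
      then have "complex_of_real (1 / 2) islimpt complex_of_real ` {0<..<1}"
        by (rule islimpt_isCont_image) (auto simp only: of_real_eq_iff eventually_neq_at_within intro: continuous_intros)
      then show ?thesis
        by simp
    qed
    show "(T z - of_real \<kappa>) * (N z + S z) - 1 = 0" if z: "z \<in> of_real ` {0<..<1}" for z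
    proof -
      obtain \<xi> :: real where \<xi>: "z = of_real \<xi>" "0 < \<xi>"
        using z by auto
      show ?thesis
        using fourier[OF \<xi>(2)] integral_exp_series_split[OF G _ pos sums abs, of 1 \<xi>]
        unfolding \<xi>(1) by (simp add: N_def S_def)
    qed
  qed (use that in auto)
  define X where "X n = 1 / real (Suc n)" for n
  \<comment> \<open>The pole is approached horizontally from inside the quadrant. At distance x its
    own term has denominator \<sigma> j + i z = i x, so multiplying by x isolates -i c j in the
    limit.\<close>
  define Z where "Z n = \<i> * of_real (\<sigma> j) + of_real (X n)" for n
  have X: "X n > 0" for n
    by (simp add: X_def)
  have X0: "X \<longlonglongrightarrow> 0"
    unfolding X_def by (rule LIMSEQ_Suc) (rule lim_1_over_n)
  have Z: "Z \<longlonglongrightarrow> \<i> * of_real (\<sigma> j)"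
    unfolding Z_def by (auto intro!: tendsto_eq_intros X0)
  have "(\<lambda>n. of_real (X n) * N (Z n)) \<longlonglongrightarrow> of_real 0 * N (\<i> * of_real (\<sigma> j))"
  proof (intro tendsto_mult tendsto_of_real X0)
    have "isCont N (\<i> * of_real (\<sigma> j))"
      using holomorphic_on_imp_continuous_on[OF N[of UNIV]] by (simp add: continuous_on_eq_continuous_at)
    then show "(\<lambda>n. N (Z n)) \<longlonglongrightarrow> N (\<i> * of_real (\<sigma> j))"
      using Z by (rule isCont_tendsto_compose)
  qed
  moreover have "(\<lambda>n. of_real (X n) * S (Z n)) \<longlonglongrightarrow> - \<i> * of_real (c j)"
  proof -
    define a where "a k n = of_real (c k) * (of_real (X n) * two_sided_exp (\<sigma> k) 1 (Z n))" for k n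
    define b where "b k = (if k = j then - \<i> * of_real (c j) else 0)" for k
    \<comment> \<open>Both quotients x/(r \<plusminus> i x) have norm at most 1 and both
      exponentials are at most exp(\<sigma> j - \<sigma> k). This majorant does not depend on n, as
      Tannery's theorem requires.\<close>
    define M where "M k = \<bar>c k\<bar> * exp (- \<sigma> k * 1) * (2 * exp (\<sigma> j))" for k
    have split: "of_real (X n) * two_sided_exp (\<sigma> k) 1 (Z n) =
        exp (of_real (\<sigma> j - \<sigma> k) - \<i> * of_real (X n)) * (of_real (X n) / (of_real (\<sigma> k - \<sigma> j) + \<i> * of_real (X n))) +
        exp (of_real (- \<sigma> j - \<sigma> k) + \<i> * of_real (X n)) * (of_real (X n) / (of_real (\<sigma> k + \<sigma> j) - \<i> * of_real (X n)))" for k n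
    proof -
      have *: "of_real (\<sigma> k) + \<i> * Z n = of_real (\<sigma> k - \<sigma> j) + \<i> * of_real (X n)"
        "of_real (\<sigma> k) - \<i> * Z n = of_real (\<sigma> k + \<sigma> j) - \<i> * of_real (X n)"
        by (simp_all add: Z_def algebra_simps)
      show ?thesis
        unfolding two_sided_exp_def * by (simp add: algebra_simps)
    qed
    have quot: "norm (of_real x / (of_real r + \<i> * of_real y)) \<le> 1" if "\<bar>x\<bar> = \<bar>y\<bar>" for x y r :: real
      using abs_Im_le_cmod[of "of_real r + \<i> * of_real y"] that by (simp add: norm_divide divide_le_eq_1)
    have "norm (of_real (X n) * two_sided_exp (\<sigma> k) 1 (Z n)) \<le> exp (\<sigma> j - \<sigma> k) * 1 + exp (- \<sigma> j - \<sigma> k) * 1" for k n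
      unfolding split
    proof (intro order_trans[OF norm_triangle_ineq] add_mono)
      show "norm (exp (of_real (\<sigma> j - \<sigma> k) - \<i> * of_real (X n)) * (of_real (X n) / (of_real (\<sigma> k - \<sigma> j) + \<i> * of_real (X n)))) \<le> exp (\<sigma> j - \<sigma> k) * 1"
        unfolding norm_mult by (intro mult_mono quot) auto
      show "norm (exp (of_real (- \<sigma> j - \<sigma> k) + \<i> * of_real (X n)) * (of_real (X n) / (of_real (\<sigma> k + \<sigma> j) - \<i> * of_real (X n)))) \<le> exp (- \<sigma> j - \<sigma> k) * 1"
        unfolding norm_mult using quot[of "X n" "- X n" "\<sigma> k + \<sigma> j"] by (intro mult_mono) auto
    qed
    moreover have "exp (\<sigma> j - \<sigma> k) * 1 + exp (- \<sigma> j - \<sigma> k) * 1 \<le> exp (- \<sigma> k * 1) * (2 * exp (\<sigma> j))" for k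
    proof -
      have "exp (- \<sigma> j - \<sigma> k) \<le> exp (\<sigma> j - \<sigma> k)"
        using spos[of j] by simp
      moreover have "exp (\<sigma> j - \<sigma> k) = exp (- \<sigma> k * 1) * exp (\<sigma> j)"
        by (simp add: exp_add[symmetric])
      ultimately show ?thesis
        by linarith
    qed
    ultimately have "norm (a k n) \<le> M k" for k n
      unfolding a_def M_def norm_mult mult.assoc norm_of_real
      by (intro mult_left_mono) (auto intro: order_trans)
    then have bound: "eventually (\<lambda>(k, n). norm (a k n) \<le> M k) (at_top \<times>\<^sub>F sequentially)"
      by (intro always_eventually) auto
    have limit: "a k \<longlonglongrightarrow> b k" for k
    proof -
      have X0': "(\<lambda>n. complex_of_real (X n)) \<longlonglongrightarrow> 0"
        using tendsto_of_real[OF X0, where 'a = complex] by simp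
      have lim0: "(\<lambda>n. exp (of_real r + s * of_real (X n)) * (of_real (X n) / (of_real q + s' * of_real (X n)))) \<longlonglongrightarrow>
          exp (of_real r) * 0" if "q \<noteq> 0" for r q :: real and s s' :: complex
        using that by (intro tendsto_mult) (auto intro!: tendsto_eq_intros X0)
      have second: "(\<lambda>n. exp (of_real (- \<sigma> j - \<sigma> k) + \<i> * of_real (X n)) * (of_real (X n) / (of_real (\<sigma> k + \<sigma> j) - \<i> * of_real (X n)))) \<longlonglongrightarrow> 0"
        using lim0[of "\<sigma> k + \<sigma> j" "- \<sigma> j - \<sigma> k" \<i> "- \<i>"] spos[of j] spos[of k] by simp
      have first: "(\<lambda>n. exp (of_real (\<sigma> j - \<sigma> k) - \<i> * of_real (X n)) * (of_real (X n) / (of_real (\<sigma> k - \<sigma> j) + \<i> * of_real (X n))))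
          \<longlonglongrightarrow> (if k = j then - \<i> else 0)"
      proof (cases "k = j")
        case True
        have "(\<lambda>n. exp (- (\<i> * of_real (X n))) * (- \<i>)) \<longlonglongrightarrow> exp (- (\<i> * 0)) * (- \<i>)"
          by (intro tendsto_mult tendsto_exp tendsto_minus tendsto_const X0')
        then show ?thesis
          using True X by (simp add: field_simps less_imp_neq[symmetric])
      next
        case False
        then have "\<sigma> k - \<sigma> j \<noteq> 0"
          using inj by (auto dest: injD)
        from lim0[OF this, of "\<sigma> j - \<sigma> k" "- \<i>" \<i>] False show ?thesis
          by simp
      qed
      have "(\<lambda>n. of_real (X n) * two_sided_exp (\<sigma> k) 1 (Z n)) \<longlonglongrightarrow> (if k = j then - \<i> else 0) + 0"
        unfolding split by (intro tendsto_add first second)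
      then have "a k \<longlonglongrightarrow> of_real (c k) * ((if k = j then - \<i> else 0) + 0)"
        unfolding a_def[abs_def] by (rule tendsto_mult_left)
      then show ?thesis
        by (simp add: b_def mult.commute split: if_splits)
    qed
    have "summable M"
      unfolding M_def using abs[of 1] by (intro summable_mult2) auto
    then have "(\<lambda>n. suminf (\<lambda>k. a k n)) \<longlonglongrightarrow> suminf b"
      using tannerys_theorem[OF limit bound] by simp
    moreover have "suminf b = - \<i> * of_real (c j)"
      using sums_single[of j "\<lambda>_. - \<i> * of_real (c j)"] by (simp add: b_def[abs_def] sums_iff)
    moreover have "suminf (\<lambda>k. a k n) = of_real (X n) * S (Z n)" for n
    proof -
      have "summable (\<lambda>k. of_real (c k) * two_sided_exp (\<sigma> k) 1 (Z n))"
        using spos abs[of 1] X[of n] by (intro holomorphic_suminf_two_sided_exp) (auto simp: Z_def)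
      then show ?thesis
        unfolding S_def by (subst suminf_mult[symmetric]) (auto simp: a_def ac_simps)
    qed
    ultimately show ?thesis
      by simp
  qed
  ultimately have "(\<lambda>n. of_real (X n) * N (Z n) + of_real (X n) * S (Z n)) \<longlonglongrightarrow>
      of_real 0 * N (\<i> * of_real (\<sigma> j)) + - \<i> * of_real (c j)"
    by (rule tendsto_add)
  then have "(\<lambda>n. Im (of_real (X n) * (N (Z n) + S (Z n)))) \<longlonglongrightarrow> Im (- \<i> * of_real (c j))"
    by (intro tendsto_Im) (simp add: distrib_left)
  moreover have "Im (of_real (X n) * (N (Z n) + S (Z n))) \<le> 0" for n
  proof -
    have ReIm: "Re (Z n) > 0" "Im (Z n) > 0"
      using X[of n] spos[of j] by (auto simp: Z_def)
    have "Im (T (Z n) - of_real \<kappa>) > 0"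
      using Im_T[OF ReIm] by simp
    moreover have "N (Z n) + S (Z n) = 1 / (T (Z n) - of_real \<kappa>)"
    proof -
      have "T (Z n) - of_real \<kappa> \<noteq> 0"
        using \<open>Im (T (Z n) - of_real \<kappa>) > 0\<close> by force
      moreover have "(N (Z n) + S (Z n)) * (T (Z n) - of_real \<kappa>) = 1"
        using id[OF ReIm(1)] by (simp add: mult.commute)
      ultimately show ?thesis
        by (simp only: eq_divide_eq if_True simp_thms)
    qed
    ultimately have "Im (N (Z n) + S (Z n)) \<le> 0"
      by (simp add: Im_divide divide_le_0_iff)
    then show ?thesis
      using X[of n] by (simp add: mult_le_0_iff)
  qed
  then have "\<exists>k. \<forall>n\<ge>k. Im (of_real (X n) * (N (Z n) + S (Z n))) \<le> 0"
    by blast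
  ultimately have "Im (- \<i> * of_real (c j)) \<le> 0"
    by (rule LIMSEQ_le_const2)
  then show ?thesis
    by simp
qed

subsection \<open>The Fourier transform of the Green's function\<close>

lemma integrable_convolution_pair:
  fixes f g :: "real \<Rightarrow> real"
  assumes f: "integrable lborel f" and g: "integrable lborel g"
  shows "integrable (lborel \<Otimes>\<^sub>M lborel) (\<lambda>(s, t). g (t - s) * f s)"
proof (rule lborel_pair.Fubini_integrable)
  have [measurable]: "f \<in> borel_measurable borel" "g \<in> borel_measurable borel"
    using borel_measurable_integrable[OF f] borel_measurable_integrable[OF g] by simp_all
  show "(\<lambda>(s, t). g (t - s) * f s) \<in> borel_measurable (lborel \<Otimes>\<^sub>M lborel)"
    by measurable
  have shift: "integrable lborel (\<lambda>t. g (t - s))" for s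
    using lborel_integrable_real_affine[OF g, of 1 "- s"] by simp
  then show "AE s in lborel. integrable lborel (\<lambda>t. case (s, t) of (s, t) \<Rightarrow> g (t - s) * f s)"
    by simp
  have "(LINT t|lborel. norm (g (t - s) * f s)) = (LINT t|lborel. norm (g t)) * norm (f s)" for s
    using lborel_integral_real_affine[of 1 "\<lambda>t. norm (g t)" "- s"] by (simp add: abs_mult)
  then show "integrable lborel (\<lambda>s. LINT t|lborel. norm (case (s, t) of (s, t) \<Rightarrow> g (t - s) * f s))"
    using f by simp
qed

lemma fourier_conv:
  fixes f g :: "real \<Rightarrow> real"
  assumes f: "integrable lborel f" and g: "integrable lborel g"
  shows "fourier (conv g f) \<xi> =
    (LINT t|lborel. exp (- (\<i> * of_real (\<xi> * t))) * of_real (g t)) *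
    (LINT t|lborel. exp (- (\<i> * of_real (\<xi> * t))) * of_real (f t))"
proof -
  have [measurable]: "f \<in> borel_measurable borel" "g \<in> borel_measurable borel"
    using borel_measurable_integrable[OF f] borel_measurable_integrable[OF g] by simp_all
  let ?e = "\<lambda>t. exp (- (\<i> * complex_of_real (\<xi> * t)))"
  let ?F = "\<lambda>s t. ?e t * complex_of_real (g (t - s) * f s)"
  have "integrable (lborel \<Otimes>\<^sub>M lborel) (case_prod ?F)"
  proof (rule Bochner_Integration.integrable_bound[OF integrable_convolution_pair[OF f g]])
    show "case_prod ?F \<in> borel_measurable (lborel \<Otimes>\<^sub>M lborel)"
      by measurable
  qed (auto simp: norm_mult)
  then have swap: "(LINT t|lborel. LINT s|lborel. ?F s t) = (LINT s|lborel. LINT t|lborel. ?F s t)"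
    by (rule lborel_pair.Fubini_integral)
  have inner: "(LINT t|lborel. ?F s t) = ?e s * of_real (f s) * (LINT t|lborel. ?e t * of_real (g t))" for s
  proof -
    have "(LINT t|lborel. ?F s t) = (LINT t|lborel. ?F s (s + 1 * t))"
      by (subst lborel_integral_real_affine[where c = 1 and t = s]) auto
    also have "\<dots> = (LINT t|lborel. (?e s * of_real (f s)) * (?e t * of_real (g t)))"
    proof (intro Bochner_Integration.integral_cong refl)
      have "?e (s + 1 * t) = ?e s * ?e t" for t
        by (simp add: exp_add[symmetric] algebra_simps)
      then show "?F s (s + 1 * t) = (?e s * of_real (f s)) * (?e t * of_real (g t))" for t
        by (simp only: of_real_mult) (simp add: ac_simps)
    qed
    finally show ?thesis
      by simp
  qed
  have "(LINT t|lborel. LINT s|lborel. ?F s t) = fourier (conv g f) \<xi>"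
  proof -
    have "conv g f = (\<lambda>t. LINT s|lborel. g (t - s) * f s)"
      by (simp add: conv_def fun_eq_iff integral_completion)
    moreover have "(LINT s|lborel. ?F s t) = ?e t * of_real (LINT s|lborel. g (t - s) * f s)" for t
      by (simp del: of_real_mult)
    moreover have "(\<lambda>t. ?e t * complex_of_real (LINT s|lborel. g (t - s) * f s)) \<in> borel_measurable lborel"
      by measurable
    ultimately show ?thesis
      by (simp add: fourier_def integral_completion)
  qed
  then show ?thesis
    using swap unfolding inner by simp
qed

text \<open>One test source suffices, provided that its transform has no zeros and can be cancelled:
  exp(-\<bar>t\<bar>), with transform 2/(1 + \<xi>^2).\<close>

lemma fourier_green_function:
  assumes green: "green_function n \<gamma> \<mu> m \<kappa> G" and [measurable]: "G \<in> borel_measurable borel"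
  shows "(Theta n \<gamma> \<mu> m (of_real \<xi>) - of_real \<kappa>) *
    (LINT t|lborel. exp (- (\<i> * of_real (\<xi> * t))) * of_real (G t)) = 1"
proof -
  let ?e = "\<lambda>t. exp (- (\<i> * complex_of_real (\<xi> * t)))"
  define h where "h t = exp (- \<bar>t\<bar>)" for t :: real
  have [measurable]: "h \<in> borel_measurable borel"
    by (simp add: h_def[abs_def])
  have G: "integrable lborel G"
    using green by (simp add: green_function_def integrable_completion)
  have "has_bochner_integral lborel (\<lambda>t. ?e t * of_real (indicator {t. \<bar>t\<bar> > 0} t * h t)) (two_sided_exp 1 0 (of_real \<xi>))"
    using has_bochner_integral_two_sided_exp[of 1 0 \<xi>] by (simp add: h_def)
  moreover have "AE t in lborel. ?e t * of_real (indicator {t. \<bar>t\<bar> > 0} t * h t) = ?e t * of_real (h t)"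
    using AE_lborel_singleton[of 0] by eventually_elim simp
  ultimately have "has_bochner_integral lborel (\<lambda>t. ?e t * of_real (h t)) (two_sided_exp 1 0 (of_real \<xi>))"
    by (subst has_bochner_integral_cong_AE[symmetric]) auto
  then have int: "integrable lborel (\<lambda>t. ?e t * of_real (h t))"
    and h_hat: "(LINT t|lborel. ?e t * of_real (h t)) = two_sided_exp 1 0 (of_real \<xi>)"
    by (auto simp: has_bochner_integral_iff)
  have h: "integrable lborel h"
    by (rule Bochner_Integration.integrable_bound[OF int]) (auto simp: norm_mult)
  have "1 + \<xi>\<^sup>2 > 0"
    by (simp add: add_pos_nonneg)
  have "two_sided_exp 1 0 (of_real \<xi>) = 2 / (1 + of_real (\<xi>\<^sup>2))"
  proof -
    have "1 + \<i> * of_real \<xi> \<noteq> 0" "1 - \<i> * of_real \<xi> \<noteq> 0" "1 + complex_of_real (\<xi>\<^sup>2) \<noteq> 0"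
      using \<open>1 + \<xi>\<^sup>2 > 0\<close> by (auto simp: complex_eq_iff)
    then show ?thesis
      by (simp add: two_sided_exp_def field_simps power2_eq_square)
  qed
  moreover have "1 + complex_of_real (\<xi>\<^sup>2) \<noteq> 0"
    using \<open>1 + \<xi>\<^sup>2 > 0\<close> by (auto simp: complex_eq_iff)
  ultimately have nz: "two_sided_exp 1 0 (of_real \<xi>) \<noteq> 0"
    by simp
  have "Theta n \<gamma> \<mu> m (of_real \<xi>) * fourier (conv G h) \<xi> - of_real \<kappa> * fourier (conv G h) \<xi> = fourier h \<xi>"
    using green h by (simp add: green_function_def solves_mode_def integrable_completion)
  moreover have "fourier h \<xi> = two_sided_exp 1 0 (of_real \<xi>)"
    unfolding fourier_def h_hat[symmetric] by (rule integral_completion) measurable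
  ultimately have "(Theta n \<gamma> \<mu> m (of_real \<xi>) - of_real \<kappa>) *
      (LINT t|lborel. ?e t * of_real (G t)) * two_sided_exp 1 0 (of_real \<xi>) = two_sided_exp 1 0 (of_real \<xi>)"
    unfolding fourier_conv[OF h G] h_hat by (simp only: left_diff_distrib mult.assoc)
  then show ?thesis
    using nz by simp
qed

subsection \<open>Termwise convolution with an exponential series\<close>

lemma integrable_exp_abs:
  assumes "\<eta> > (0::real)"
  shows "integrable lborel (\<lambda>t. exp (- \<eta> * \<bar>t\<bar>))"
proof -
  have "integrable lborel (\<lambda>t. exp (- (\<i> * of_real (0 * t))) * complex_of_real (indicator {t. \<bar>t\<bar> > 0} t * exp (- \<eta> * \<bar>t\<bar>)))"
    using has_bochner_integral_two_sided_exp[OF assms order_refl, of 0] by (auto simp: has_bochner_integral_iff)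
  then show ?thesis
  proof (rule Bochner_Integration.integrable_bound)
    show "AE t in lborel. norm (exp (- \<eta> * \<bar>t\<bar>)) \<le>
        norm (exp (- (\<i> * of_real (0 * t))) * complex_of_real (indicator {t. \<bar>t\<bar> > 0} t * exp (- \<eta> * \<bar>t\<bar>)))"
      using AE_lborel_singleton[of 0] by eventually_elim (auto simp: norm_mult)
  qed simp
qed

text \<open>In the tails the weight beats the growth of h with net rates s + \<delta> and s +
  \<open>\<delta>\<^sub>0\<close>, whose minimum \<eta> is positive; on the compact rest local
  integrability is enough.\<close>

lemma integrable_exp_weight:
  fixes h :: "real \<Rightarrow> real"
  assumes loc: "\<And>a b. h absolutely_integrable_on {a..b}" and s: "s > 0" "\<delta> > - s" "\<delta>\<^sub>0 > - s"
    and top: "h \<in> O[at_top](\<lambda>t. exp (- \<delta> * t))" and bot: "h \<in> O[at_bot](\<lambda>t. exp (\<delta>\<^sub>0 * t))"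
  shows "integrable lebesgue (\<lambda>t. exp (- s * \<bar>t\<bar>) * h t)"
proof -
  obtain C1 where "C1 > 0" and C1: "eventually (\<lambda>t. norm (h t) \<le> C1 * norm (exp (- \<delta> * t))) at_top"
    using landau_o.bigE[OF top] by blast
  obtain C2 where "C2 > 0" and C2: "eventually (\<lambda>t. norm (h t) \<le> C2 * norm (exp (\<delta>\<^sub>0 * t))) at_bot"
    using landau_o.bigE[OF bot] by blast
  obtain T1 where T1: "\<And>t. t \<ge> T1 \<Longrightarrow> norm (h t) \<le> C1 * norm (exp (- \<delta> * t))"
    using C1 by (auto simp: eventually_at_top_linorder)
  obtain T2 where T2: "\<And>t. t \<le> T2 \<Longrightarrow> norm (h t) \<le> C2 * norm (exp (\<delta>\<^sub>0 * t))"
    using C2 by (auto simp: eventually_at_bot_linorder)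
  define T where "T = max \<bar>T1\<bar> \<bar>T2\<bar>"
  define \<eta> where "\<eta> = min (s + \<delta>) (s + \<delta>\<^sub>0)"
  define C where "C = max C1 C2"
  have \<eta>: "\<eta> > 0"
    using s by (simp add: \<eta>_def)
  have loc': "integrable lebesgue (\<lambda>t. indicat_real {a..b} t * h t)" for a b
    using loc[of a b] by (simp add: set_integrable_def)
  \<comment> \<open>h is the pointwise limit of its truncations to [-n, n], which are measurable by
    local integrability.\<close>
  have meas: "h \<in> borel_measurable lebesgue"
  proof (rule borel_measurable_LIMSEQ_real)
    show "(\<lambda>n. indicat_real {- real n..real n} t * h t) \<longlonglongrightarrow> h t" for t
    proof (rule tendsto_eventually)
      obtain N :: nat where "\<bar>t\<bar> \<le> real N"
        using real_arch_simple by blast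
      then show "\<forall>\<^sub>F n in sequentially. indicat_real {- real n..real n} t * h t = h t"
        unfolding eventually_sequentially by (intro exI[of _ N]) (auto simp: indicator_def)
    qed
    show "(\<lambda>t. indicat_real {- real n..real n} t * h t) \<in> borel_measurable lebesgue" for n
      by (rule borel_measurable_integrable[OF loc'])
  qed
  have tail: "exp (- s * \<bar>t\<bar>) * \<bar>h t\<bar> \<le> C * exp (- \<eta> * \<bar>t\<bar>)" if t: "t \<notin> {-T..T}" for t
  proof -
    consider "t > T" | "t < - T"
      using t by force
    then show ?thesis
    proof cases
      case 1
      then have "t \<ge> T1" "t \<ge> 0"
        by (auto simp: T_def)
      then have "exp (- s * \<bar>t\<bar>) * \<bar>h t\<bar> \<le> exp (- s * t) * (C1 * exp (- \<delta> * t))"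
        using T1[of t] by (intro mult_mono) auto
      also have "\<dots> = C1 * exp (- (s + \<delta>) * t)"
        by (simp add: exp_add[symmetric] algebra_simps)
      also have "\<dots> \<le> C * exp (- \<eta> * \<bar>t\<bar>)"
      proof (intro mult_mono)
        have "\<eta> * t \<le> (s + \<delta>) * t"
          using \<open>t \<ge> 0\<close> by (intro mult_right_mono) (auto simp: \<eta>_def)
        then show "exp (- (s + \<delta>) * t) \<le> exp (- \<eta> * \<bar>t\<bar>)"
          using \<open>t \<ge> 0\<close> by (simp add: algebra_simps)
      qed (use \<open>C1 > 0\<close> in \<open>auto simp: C_def\<close>)
      finally show ?thesis .
    next
      case 2
      then have "t \<le> T2" "t \<le> 0"
        by (auto simp: T_def)
      then have "exp (- s * \<bar>t\<bar>) * \<bar>h t\<bar> \<le> exp (- s * - t) * (C2 * exp (\<delta>\<^sub>0 * t))"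
        using T2[of t] by (intro mult_mono) auto
      also have "\<dots> = C2 * exp (- (s + \<delta>\<^sub>0) * - t)"
        by (simp add: exp_add[symmetric] algebra_simps)
      also have "\<dots> \<le> C * exp (- \<eta> * \<bar>t\<bar>)"
      proof (intro mult_mono)
        have "\<eta> * - t \<le> (s + \<delta>\<^sub>0) * - t"
          using \<open>t \<le> 0\<close> by (intro mult_right_mono) (auto simp: \<eta>_def)
        then show "exp (- (s + \<delta>\<^sub>0) * - t) \<le> exp (- \<eta> * \<bar>t\<bar>)"
          using \<open>t \<le> 0\<close> by (simp add: algebra_simps)
      qed (use \<open>C2 > 0\<close> in \<open>auto simp: C_def\<close>)
      finally show ?thesis .
    qed
  qed
  show ?thesis
  proof (rule Bochner_Integration.integrable_bound)
    show "integrable lebesgue (\<lambda>t. \<bar>indicat_real {-T..T} t * h t\<bar> + C * exp (- \<eta> * \<bar>t\<bar>))"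
      using integrable_exp_abs[OF \<eta>] by (intro Bochner_Integration.integrable_add integrable_abs loc' integrable_mult_right) (simp add: integrable_completion)
    show "(\<lambda>t. exp (- s * \<bar>t\<bar>) * h t) \<in> borel_measurable lebesgue"
      by (intro borel_measurable_times meas measurable_completion) simp
    have bound: "exp (- s * \<bar>t\<bar>) * \<bar>h t\<bar> \<le> \<bar>indicat_real {-T..T} t * h t\<bar> + C * exp (- \<eta> * \<bar>t\<bar>)" for t
    proof (cases "t \<in> {-T..T}")
      case True
      have "exp (- s * \<bar>t\<bar>) * \<bar>h t\<bar> \<le> 1 * \<bar>h t\<bar>"
        using s by (intro mult_right_mono) auto
      moreover have "C * exp (- \<eta> * \<bar>t\<bar>) \<ge> 0"
        using \<open>C1 > 0\<close> by (auto simp: C_def)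
      ultimately show ?thesis
        using True by simp
    next
      case False
      then show ?thesis
        using tail[OF False] by simp
    qed
    show "AE t in lebesgue. norm (exp (- s * \<bar>t\<bar>) * h t) \<le> norm (\<bar>indicat_real {-T..T} t * h t\<bar> + C * exp (- \<eta> * \<bar>t\<bar>))"
      using order_trans[OF bound abs_ge_self] by (intro AE_I2) (simp add: abs_mult)
  qed
qed

locale exp_series_kernel = exp_weighted s h for s h +
  fixes c \<sigma> :: "nat \<Rightarrow> real" and G :: "real \<Rightarrow> real"
  assumes coeff_nonneg: "\<And>j. c j \<ge> 0" and rate_ge: "\<And>j. \<sigma> j \<ge> s"
    and G_sums: "\<And>t. t \<noteq> 0 \<Longrightarrow> (\<lambda>j. c j * exp (- \<sigma> j * \<bar>t\<bar>)) sums G t"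
    and integrable_G: "integrable lborel G"
begin

lemma measurable_G [measurable]: "G \<in> borel_measurable borel"
  using borel_measurable_integrable[OF integrable_G] by simp

lemma G_nonneg: "t \<noteq> 0 \<Longrightarrow> G t \<ge> 0"
  by (rule sums_le[OF _ sums_zero G_sums]) (auto simp: coeff_nonneg)

text \<open>All rates are at least s, so in passing from \<epsilon> to \<bar>x\<bar> each term of
  the series shrinks by the factor exp(-s(\<bar>x\<bar> - \<epsilon>)) or more. Nonnegative
  coefficients let this be summed.\<close>

lemma G_decay:
  assumes "\<epsilon> > 0" "\<bar>x\<bar> \<ge> \<epsilon>"
  shows "\<bar>G x\<bar> \<le> exp (s * \<epsilon>) * G \<epsilon> * exp (- s * \<bar>x\<bar>)"
proof -
  have x: "x \<noteq> 0"
    using assms by auto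
  have sums: "(\<lambda>j. c j * exp (- \<sigma> j * \<bar>\<epsilon>\<bar>) * exp (- s * (\<bar>x\<bar> - \<epsilon>))) sums (G \<epsilon> * exp (- s * (\<bar>x\<bar> - \<epsilon>)))"
    using assms by (intro sums_mult2 G_sums) auto
  have le: "c j * exp (- \<sigma> j * \<bar>x\<bar>) \<le> c j * exp (- \<sigma> j * \<bar>\<epsilon>\<bar>) * exp (- s * (\<bar>x\<bar> - \<epsilon>))" for j
  proof -
    have "s * (\<bar>x\<bar> - \<epsilon>) \<le> \<sigma> j * (\<bar>x\<bar> - \<epsilon>)"
      using rate_ge[of j] assms by (intro mult_right_mono) auto
    then have "- \<sigma> j * \<bar>x\<bar> \<le> - \<sigma> j * \<bar>\<epsilon>\<bar> + - s * (\<bar>x\<bar> - \<epsilon>)"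
      using assms by (simp add: algebra_simps)
    then show ?thesis
      unfolding mult.assoc exp_add[symmetric] using coeff_nonneg by (intro mult_left_mono) auto
  qed
  have "G x \<le> G \<epsilon> * exp (- s * (\<bar>x\<bar> - \<epsilon>))"
    by (rule sums_le[OF le G_sums[OF x] sums])
  also have "\<dots> = exp (s * \<epsilon>) * G \<epsilon> * exp (- s * \<bar>x\<bar>)"
  proof -
    have "- s * (\<bar>x\<bar> - \<epsilon>) = s * \<epsilon> + - s * \<bar>x\<bar>"
      by (simp add: algebra_simps)
    then show ?thesis
      by (simp only: exp_add) simp
  qed
  finally show ?thesis
    using G_nonneg[OF x] by simp
qed

lemma measurable_reflect: "(\<lambda>t'. G (t - t')) \<in> borel_measurable lebesgue"
  by (intro measurable_completion) measurable

lemma integrable_far: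
  assumes A: "A \<in> sets lebesgue" and "\<epsilon> > 0" "\<And>t'. t' \<in> A \<Longrightarrow> \<bar>t - t'\<bar> \<ge> \<epsilon>"
  shows "integrable lebesgue (\<lambda>t'. indicator A t' * G (t - t') * h t')"
proof -
  define K where "K = exp (s * \<epsilon>) * G \<epsilon>"
  have K: "K \<ge> 0"
    using G_nonneg[of \<epsilon>] assms(2) by (simp add: K_def)
  have bound: "\<bar>indicator A t' * G (t - t')\<bar> \<le> K * exp (s * \<bar>t\<bar>) * exp (- s * \<bar>t'\<bar>)" for t'
  proof (cases "t' \<in> A")
    case True
    then have "\<bar>indicator A t' * G (t - t')\<bar> \<le> K * exp (- s * \<bar>t - t'\<bar>)"
      using G_decay[OF assms(2) assms(3)[of t']] by (simp add: K_def)
    also have "\<dots> \<le> K * (exp (s * \<bar>t\<bar>) * exp (- s * \<bar>t'\<bar>))"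
      by (intro mult_left_mono exp_shift K)
    finally show ?thesis
      by (simp only: mult.assoc)
  qed (use K in simp)
  show ?thesis
    by (rule integrable_kernel[OF _ bound])
       (intro borel_measurable_times borel_measurable_indicator A measurable_reflect)
qed

text \<open>At distance \<epsilon> or more from t the decay of G always makes the product
  integrable, so existence of the convolution integral is a question about the neighbourhood of t' =
  t only.\<close>

lemma integrable_near_imp:
  assumes A: "A \<in> sets lebesgue" and "\<epsilon> > 0" "\<And>t'. t' \<notin> A \<Longrightarrow> \<bar>t - t'\<bar> \<ge> \<epsilon>"
    and near: "integrable lebesgue (\<lambda>t'. indicator A t' * G (t - t') * h t')"
  shows "integrable lebesgue (\<lambda>t'. G (t - t') * h t')"
proof -
  have "integrable lebesgue (\<lambda>t'. indicator A t' * G (t - t') * h t' + indicator (- A) t' * G (t - t') * h t')"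
    using A assms(2,3) by (intro Bochner_Integration.integrable_add near integrable_far[where \<epsilon> = \<epsilon>]) (auto simp: sets.compl_sets Compl_in_sets_lebesgue)
  moreover have "indicator A t' * G (t - t') * h t' + indicator (- A) t' * G (t - t') * h t' = G (t - t') * h t'" for t'
    by (auto simp: indicator_def)
  ultimately show ?thesis
    by simp
qed

lemma integrable_if_locally_bounded:
  assumes "\<epsilon> > 0" "bounded (h ` ball t \<epsilon>)"
  shows "integrable lebesgue (\<lambda>t'. G (t - t') * h t')"
proof (rule integrable_near_imp[where A = "ball t \<epsilon>" and \<epsilon> = \<epsilon>])
  obtain B where B: "\<And>t'. t' \<in> ball t \<epsilon> \<Longrightarrow> \<bar>h t'\<bar> \<le> B"
    using assms(2) unfolding bounded_iff real_norm_def by blast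
  show "integrable lebesgue (\<lambda>t'. indicator (ball t \<epsilon>) t' * G (t - t') * h t')"
  proof (rule Bochner_Integration.integrable_bound)
    have "integrable lborel (\<lambda>t'. G (t + (-1) * t'))"
      by (rule lborel_integrable_real_affine[OF integrable_G]) simp
    then have "integrable lebesgue (\<lambda>t'. G (t - t'))"
      by (simp add: integrable_completion)
    then show "integrable lebesgue (\<lambda>t'. B * \<bar>G (t - t')\<bar>)"
      by (intro integrable_mult_right integrable_abs)
    show "(\<lambda>t'. indicator (ball t \<epsilon>) t' * G (t - t') * h t') \<in> borel_measurable lebesgue"
      by (intro borel_measurable_times borel_measurable_indicator measurable_reflect measurable_h) simp
    have "\<bar>G (t - t')\<bar> * \<bar>h t'\<bar> \<le> \<bar>B * \<bar>G (t - t')\<bar>\<bar>" if "t' \<in> ball t \<epsilon>" for t'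
      using B[OF that] mult_left_mono[of "\<bar>h t'\<bar>" "\<bar>B\<bar>" "\<bar>G (t - t')\<bar>"] by (simp add: abs_mult mult.commute)
    then show "AE t' in lebesgue. norm (indicator (ball t \<epsilon>) t' * G (t - t') * h t') \<le> norm (B * \<bar>G (t - t')\<bar>)"
      by (intro AE_I2) (auto simp: indicator_def abs_mult)
  qed
qed (use assms in \<open>auto simp: dist_real_def\<close>)

text \<open>h need not be integrable, so Fubini's theorem for the convolution of two integrable
  functions is applied to all truncations of h to [-N, N], outside one null set. For a given t,
  taking N \<ge> \<bar>t\<bar> + 1 leaves only points at distance at least 1.\<close>

lemma AE_integrable: "AE t in lebesgue. integrable lebesgue (\<lambda>t'. G (t - t') * h t')"
proof -
  \<comment> \<open>The product measure is that of \<open>lborel\<close>, so the Lebesgue measurable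
    h is exchanged for a Borel function that agrees with it almost everywhere.\<close>
  obtain h' where h': "h' \<in> borel_measurable lborel" "AE t in lborel. h t = h' t"
    using completion_ex_borel_measurable_real[OF measurable_h] by blast
  have [measurable]: "h' \<in> borel_measurable borel"
    using h'(1) by simp
  have ae: "AE t in lebesgue. h t = h' t"
    using h'(2) by (rule AE_completion)
  define f where "f N t = indicator {- real N..real N} t * h' t" for N :: nat and t
  have "integrable lborel (f N)" for N
  proof -
    have "integrable lebesgue (f N)"
    proof (rule integrable_cong_AE_imp[OF integrable_indicator[of "{- real N..real N}" "- real N" "real N"]])
      show "f N \<in> borel_measurable lebesgue"
        unfolding f_def by (intro measurable_completion) measurable
      show "AE t in lebesgue. indicat_real {- real N..real N} t * h t = f N t"
        using ae by eventually_elim (simp add: f_def)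
    qed auto
    moreover have "f N \<in> borel_measurable lborel"
      unfolding f_def by measurable
    ultimately show ?thesis
      by (simp add: integrable_completion)
  qed
  then have "AE t in lborel. integrable lborel (\<lambda>t'. G (t - t') * f N t')" for N
    using lborel_pair.AE_integrable_snd[OF integrable_convolution_pair[OF _ integrable_G]] by simp
  then have "AE t in lborel. \<forall>N. integrable lborel (\<lambda>t'. G (t - t') * f N t')"
    by (simp add: AE_all_countable)
  then have "AE t in lebesgue. \<forall>N. integrable lborel (\<lambda>t'. G (t - t') * f N t')"
    by (rule AE_completion)
  then show ?thesis
  proof eventually_elim
    case (elim t)
    obtain N :: nat where N: "\<bar>t\<bar> + 1 \<le> real N"
      using real_arch_simple by blast
    show ?case
    proof (rule integrable_near_imp[where A = "{- real N..real N}" and \<epsilon> = 1])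
      show "integrable lebesgue (\<lambda>t'. indicator {- real N..real N} t' * G (t - t') * h t')"
      proof (rule integrable_cong_AE_imp)
        show "integrable lebesgue (\<lambda>t'. G (t - t') * f N t')"
          using elim by (simp add: integrable_completion f_def)
        show "(\<lambda>t'. indicator {- real N..real N} t' * G (t - t') * h t') \<in> borel_measurable lebesgue"
          by (intro borel_measurable_times borel_measurable_indicator measurable_reflect measurable_h) simp
        show "AE t' in lebesgue. G (t - t') * f N t' = indicator {- real N..real N} t' * G (t - t') * h t'"
          using ae by eventually_elim (simp add: f_def)
      qed
      show "\<bar>t - t'\<bar> \<ge> 1" if "t' \<notin> {- real N..real N}" for t'
        using that N by (auto simp: abs_if split: if_splits)
    qed auto
  qed
qed

lemma exp_weighted_rate: "exp_weighted (\<sigma> j) h"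
proof
  show "\<sigma> j > 0"
    using rate_ge[of j] sigma_pos by linarith
  show "integrable lebesgue (\<lambda>t. exp (- \<sigma> j * \<bar>t\<bar>) * h t)"
    using rate_ge[of j]
    by (intro integrable_kernel[where C = 1]) (auto intro!: measurable_completion mult_right_mono)
qed

text \<open>With nonnegative coefficients the absolute values of the terms sum exactly to \<bar>G(t
  - t') h(t')\<bar>. The L1 norms of the terms thus have partial sums bounded by the integral
  assumed finite, and dominated exchange applies.\<close>

lemma conv_sums:
  assumes int: "integrable lebesgue (\<lambda>t'. G (t - t') * h t')"
  shows "(\<lambda>j. c j * (LINT t'|lebesgue. exp (- \<sigma> j * \<bar>t - t'\<bar>) * h t')) sums conv G h t"
proof -
  let ?f = "\<lambda>j t'. c j * (exp (- \<sigma> j * \<bar>t - t'\<bar>) * h t')"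
  have f: "integrable lebesgue (?f j)" for j
    by (intro integrable_mult_right exp_weighted.integrable_exp_kernel exp_weighted_rate)
  have norm_f: "norm (?f j t') = c j * exp (- \<sigma> j * \<bar>t - t'\<bar>) * \<bar>h t'\<bar>" for j t'
    using coeff_nonneg[of j] by (simp add: abs_mult)
  have ae: "AE t' in lebesgue. t' \<noteq> t"
    by (rule AE_neq)
  have norm_sums: "(\<lambda>j. norm (?f j t')) sums (norm (G (t - t') * h t'))" if "t' \<noteq> t" for t'
    unfolding norm_f using sums_mult2[OF G_sums[of "t - t'"], of "\<bar>h t'\<bar>"] G_nonneg[of "t - t'"] that
    by (simp add: abs_mult)
  have "summable (\<lambda>j. LINT t'|lebesgue. norm (?f j t'))"
  proof (rule bounded_imp_summable[where B = "LINT t'|lebesgue. norm (G (t - t') * h t')"])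
    fix n
    have "(\<Sum>j\<le>n. LINT t'|lebesgue. norm (?f j t')) = (LINT t'|lebesgue. (\<Sum>j\<le>n. norm (?f j t')))"
      using f by (intro Bochner_Integration.integral_sum[symmetric] integrable_norm)
    also have "\<dots> \<le> (LINT t'|lebesgue. norm (G (t - t') * h t'))"
    proof (rule integral_mono_AE)
      show "AE t' in lebesgue. (\<Sum>j\<le>n. norm (?f j t')) \<le> norm (G (t - t') * h t')"
        using ae
      proof eventually_elim
        case (elim t')
        then show ?case
          using norm_sums[OF elim] by (metis (no_types, lifting) finite_atMost norm_ge_zero sum_le_suminf sums_iff)
      qed
    qed (use f int in \<open>auto intro!: Bochner_Integration.integrable_sum integrable_norm\<close>)
    finally show "(\<Sum>j\<le>n. LINT t'|lebesgue. norm (?f j t')) \<le> (LINT t'|lebesgue. norm (G (t - t') * h t'))" .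
  qed simp
  moreover have "AE t' in lebesgue. summable (\<lambda>j. norm (?f j t'))"
    using ae by eventually_elim (use norm_sums in \<open>auto simp: sums_iff\<close>)
  ultimately have "(\<lambda>j. LINT t'|lebesgue. ?f j t') sums (LINT t'|lebesgue. (\<Sum>j. ?f j t'))"
    using f by (intro sums_integral)
  moreover have "(LINT t'|lebesgue. (\<Sum>j. ?f j t')) = conv G h t"
    unfolding conv_def
  proof (rule integral_cong_AE)
    show "AE t' in lebesgue. (\<Sum>j. ?f j t') = G (t - t') * h t'"
      using ae
    proof eventually_elim
      case (elim t')
      then show ?case
        using sums_mult2[OF G_sums[of "t - t'"], of "h t'"] by (simp add: sums_iff mult.assoc)
    qed
    show "(\<lambda>t'. \<Sum>j. ?f j t') \<in> borel_measurable lebesgue"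
      using f by (intro borel_measurable_suminf) (rule borel_measurable_integrable)
  qed (use int in \<open>auto intro: borel_measurable_integrable\<close>)
  ultimately show ?thesis
    by simp
qed

end

section \<open>From the given expansion to the kernel series\<close>

lemma abs_summable_exp_series:
  fixes c \<sigma> :: "nat \<Rightarrow> real"
  assumes "x > 0" and conv: "summable (\<lambda>j. c j * exp (- \<sigma> j * (x / 2)))"
    and sum: "summable (\<lambda>j. exp (- \<sigma> j * (x / 2)))"
  shows "summable (\<lambda>j. \<bar>c j\<bar> * exp (- \<sigma> j * x))"
proof -
  \<comment> \<open>Half of the exponential keeps the coefficients bounded, by convergence at x/2;
    the other half is summable by the sparsity of the exponents.\<close>
  obtain K where K: "\<And>j. norm (c j * exp (- \<sigma> j * (x / 2))) \<le> K"
    using convergent_imp_Bseq[OF convergentI[OF summable_LIMSEQ_zero[OF conv]]] by (auto simp: Bseq_def)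
  show ?thesis
  proof (rule summable_comparison_test'[OF summable_mult[OF sum, of K]])
    fix j
    have "exp (- \<sigma> j * x) = exp (- \<sigma> j * (x / 2)) * exp (- \<sigma> j * (x / 2))"
      by (simp add: exp_add[symmetric])
    moreover have "\<bar>c j\<bar> * exp (- \<sigma> j * (x / 2)) * exp (- \<sigma> j * (x / 2)) \<le> K * exp (- \<sigma> j * (x / 2))"
      using K[of j] by (intro mult_right_mono) (auto simp: abs_mult)
    ultimately show "norm (\<bar>c j\<bar> * exp (- \<sigma> j * x)) \<le> K * exp (- \<sigma> j * (x / 2))"
      by (simp add: mult.assoc)
  qed
qed

lemma green_expansion_sums:
  assumes "green_expansion \<sigma> \<tau> c c' G" "\<And>j. \<tau> j = 0" "t \<noteq> 0"
  shows "(\<lambda>j. c j * exp (- \<sigma> j * \<bar>t\<bar>)) sums G t"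
proof -
  let ?f = "\<lambda>j. c j * exp (- \<sigma> j * \<bar>t\<bar>)"
  have "summable (\<lambda>j. ?f (Suc j))" "G t = ?f 0 + (\<Sum>j. ?f (Suc j))"
    using assms by (auto simp: green_expansion_def mult.commute)
  then show ?thesis
    using sums_Suc[OF summable_sums, of ?f] by (simp add: add.commute)
qed

text \<open>Borel rather than Lebesgue measurability is what the integrals over
  \<open>lborel\<close> and the product measure require. The value at 0 is not governed by the
  series and is split off.\<close>

lemma borel_measurable_exp_series:
  fixes G :: "real \<Rightarrow> real"
  assumes "\<And>t. t \<noteq> 0 \<Longrightarrow> (\<lambda>j. c j * exp (- \<sigma> j * \<bar>t\<bar>)) sums G t"
  shows "G \<in> borel_measurable borel"
proof -
  have "G = (\<lambda>t. if t = 0 then G 0 else (\<Sum>j. c j * exp (- \<sigma> j * \<bar>t\<bar>)))"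
    using sums_unique[OF assms] by auto
  also have "\<dots> \<in> borel_measurable borel"
    by measurable
  finally show ?thesis .
qed

text \<open>For locally integrable h and singular G the integral defining w(t) can fail to exist,
  and its value is then the default 0. The recovery formula is therefore tied to the existence of
  that integral, which is itself part of the conclusion almost everywhere and wherever h is locally
  bounded.\<close>

theorem corollary4p7:
  fixes \<gamma> \<kappa> \<delta> \<delta>\<^sub>0 :: real and m :: nat
    and \<mu> \<sigma> \<tau> c c' :: "nat \<Rightarrow> real"
    and G h w :: "real \<Rightarrow> real"
    and W :: "nat \<Rightarrow> real \<Rightarrow> complex"
  assumes "0 < \<gamma>" "\<gamma> < 1"
    and "CARD('n::finite) \<ge> 2"
    and "0 \<le> \<kappa>" "\<kappa> < Lambda_const CARD('n) \<gamma>"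
    and "sphere_eigenvalues TYPE(real ^ 'n) \<mu>"
    and "pole_parameters CARD('n) \<gamma> \<mu> m \<kappa> \<sigma> \<tau>"
    and "green_function CARD('n) \<gamma> \<mu> m \<kappa> G"
    and "green_expansion \<sigma> \<tau> c c' G"
    and "\<And>a b. h absolutely_integrable_on {a..b}"
    and "\<delta> > - \<sigma> 0" "\<delta>\<^sub>0 > - \<sigma> 0"
    and "h \<in> O[at_top](\<lambda>t. exp (- \<delta> * t))"
    and "h \<in> O[at_bot](\<lambda>t. exp (\<delta>\<^sub>0 * t))"
    and "\<And>t. w t = conv G h t"
    and "\<And>j t. W j t =
           (LINT t'|lebesgue. exp (- Complex (\<sigma> j) (\<tau> j) * of_real \<bar>t - t'\<bar>) * of_real (h t'))"
  shows "(\<forall>j t. integrable lebesgue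
             (\<lambda>t'. exp (- Complex (\<sigma> j) (\<tau> j) * of_real \<bar>t - t'\<bar>) * complex_of_real (h t'))) \<and>
         (\<forall>j. solves_ode (Complex (\<sigma> j) (\<tau> j)) h (W j)) \<and>
         (AE t in lebesgue. integrable lebesgue (\<lambda>t'. G (t - t') * h t')) \<and>
         (\<forall>t. (\<exists>\<epsilon>>0. bounded (h ` ball t \<epsilon>)) \<longrightarrow> integrable lebesgue (\<lambda>t'. G (t - t') * h t')) \<and>
         (\<forall>t. integrable lebesgue (\<lambda>t'. G (t - t') * h t') \<longrightarrow>
              summable (\<lambda>j. of_real (c j) * W j t) \<and>
              w t = Re (\<Sum>j. of_real (c j) * W j t))"
proof -
  define C where "C = 2 powr (2 * \<gamma>)"
  define a where "a = A_coef CARD('n) \<gamma> \<mu> m"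
  define b where "b = B_coef CARD('n) \<gamma> \<mu> m"
  have Theta: "Theta CARD('n) \<gamma> \<mu> m = Gamma_symbol C a b"
    by (simp add: Theta_eq_Gamma_symbol C_def a_def b_def)
  have "\<mu> m \<ge> 0"
    using assms(6) by (rule sphere_eigenvalues_nonneg)
  \<comment> \<open>a - b = \<gamma>, and a + b is 1 plus the square root, which is nonnegative
    because \<mu> m is.\<close>
  then have ab: "C > 0" "0 < a + b" "b < a" "a < b + 1"
    using assms(1,2) by (auto simp: C_def a_def b_def A_coef_def B_coef_def add_pos_nonneg)
  note params = assms(7)[unfolded pole_parameters_def Theta]
  have "\<sigma> j \<ge> \<sigma> 0" for j
  proof (cases "j = 0")
    case False
    then have "j \<ge> 1"
      by simp
    then show ?thesis
      using params by (meson less_imp_le)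
  qed simp
  moreover have "\<sigma> 0 > 0"
    using params by blast
  ultimately have \<sigma>: "\<sigma> j \<ge> \<sigma> 0" "\<sigma> 0 > 0" for j
    by blast+
  have \<sigma>_pos: "\<sigma> j > 0" for j
    using \<sigma>(1)[of j] \<sigma>(2) by linarith
  have pole: "is_pole (\<lambda>z. 1 / (Gamma_symbol C a b z - of_real \<kappa>)) (Complex (\<tau> j) (\<sigma> j))" for j
  proof -
    have "Complex (\<tau> j) (\<sigma> j) \<in> {z. is_pole (\<lambda>z. 1 / (Gamma_symbol C a b z - of_real \<kappa>)) z}"
      unfolding params[THEN conjunct1] by blast
    then show ?thesis
      by simp
  qed
  have \<tau>: "\<tau> j = 0" for j
    using is_pole_Gamma_symbol_axes[OF ab pole[of j]] \<sigma>_pos[of j] params by simp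
  have pole': "is_pole (\<lambda>z. 1 / (Gamma_symbol C a b z - of_real \<kappa>)) (\<i> * of_real (\<sigma> j))" for j
    using pole[of j] by (simp add: \<tau> Complex_eq)
  \<comment> \<open>Only the pairs of parameters are assumed distinct; with all second components 0
    the first ones must be.\<close>
  have inj: "inj \<sigma>"
    using params by (simp add: inj_def \<tau>)
  have sums: "(\<lambda>j. c j * exp (- \<sigma> j * \<bar>t\<bar>)) sums G t" if "t \<noteq> 0" for t
    using green_expansion_sums[OF assms(9) \<tau> that] .
  have abs: "summable (\<lambda>j. \<bar>c j\<bar> * exp (- \<sigma> j * x))" if "x > 0" for x
  proof (rule abs_summable_exp_series[OF that])
    show "summable (\<lambda>j. c j * exp (- \<sigma> j * (x / 2)))"
      using sums[of "x / 2"] that by (simp add: sums_iff)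
    show "summable (\<lambda>j. exp (- \<sigma> j * (x / 2)))"
      using that by (intro summable_exp_poles[OF ab _ \<sigma>_pos inj pole']) simp
  qed
  have G_meas: "G \<in> borel_measurable borel"
    by (rule borel_measurable_exp_series[OF sums])
  then have G_int: "integrable lborel G"
    using assms(8) by (simp add: green_function_def integrable_completion)
  have c_nonneg: "c j \<ge> 0" for j
  proof (rule exp_series_coeff_nonneg[OF G_int \<sigma> inj sums abs])
    show "Gamma_symbol C a b holomorphic_on {z. Re z > 0}"
      by (rule holomorphic_on_subset[OF holomorphic_Gamma_symbol]) (auto intro: Gamma_symbol_regular_Re)
    show "Im (Gamma_symbol C a b z) > 0" if "Re z > 0" "Im z > 0" for z
      using Im_Gamma_symbol_pos[OF ab that] .
    show "(Gamma_symbol C a b (of_real \<xi>) - of_real \<kappa>) *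
        (LINT t|lborel. exp (- (\<i> * of_real (\<xi> * t))) * of_real (G t)) = 1" for \<xi>
      using fourier_green_function[OF assms(8) G_meas, of \<xi>] by (simp only: Theta)
  qed
  interpret exp_series_kernel "\<sigma> 0" h c \<sigma> G
  proof
    show "integrable lebesgue (\<lambda>t. exp (- \<sigma> 0 * \<bar>t\<bar>) * h t)"
      by (rule integrable_exp_weight[OF assms(10) \<sigma>(2) assms(11,12,13,14)])
  qed (use \<sigma> c_nonneg sums G_int in auto)
  \<comment> \<open>Since the exponents are real, each W is a real function embedded in the complex
    numbers, and the real part in the conclusion loses nothing.\<close>
  have kernel_of_real: "exp (- Complex (\<sigma> j) (\<tau> j) * of_real \<bar>t - t'\<bar>) * complex_of_real (h t') =
      complex_of_real (exp (- \<sigma> j * \<bar>t - t'\<bar>) * h t')" for j t t'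
    by (simp add: \<tau> Complex_eq exp_of_real[symmetric])
  have W: "W j t = of_real (exp_weighted.kernel_conv (\<sigma> j) h t)" for j t
    unfolding assms(16) kernel_of_real exp_weighted.kernel_conv_def[OF exp_weighted_rate] by (simp del: of_real_mult)
  show ?thesis
  proof (intro conjI allI impI)
    show "integrable lebesgue (\<lambda>t'. exp (- Complex (\<sigma> j) (\<tau> j) * of_real \<bar>t - t'\<bar>) * complex_of_real (h t'))" for j t
      unfolding kernel_of_real
      by (intro integrable_of_real exp_weighted.integrable_exp_kernel exp_weighted_rate)
    show "solves_ode (Complex (\<sigma> j) (\<tau> j)) h (W j)" for j
    proof -
      have "W j = (\<lambda>t. of_real (exp_weighted.kernel_conv (\<sigma> j) h t))" "Complex (\<sigma> j) (\<tau> j) = of_real (\<sigma> j)"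
        using W by (auto simp: \<tau> Complex_eq)
      then show ?thesis
        using exp_weighted.solves_ode_kernel_conv[OF exp_weighted_rate, of j] by simp
    qed
    show "AE t in lebesgue. integrable lebesgue (\<lambda>t'. G (t - t') * h t')"
      by (rule AE_integrable)
    show "integrable lebesgue (\<lambda>t'. G (t - t') * h t')" if "\<exists>\<epsilon>>0. bounded (h ` ball t \<epsilon>)" for t
      using that integrable_if_locally_bounded by blast
    fix t assume "integrable lebesgue (\<lambda>t'. G (t - t') * h t')"
    then have "(\<lambda>j. c j * exp_weighted.kernel_conv (\<sigma> j) h t) sums w t"
      using conv_sums unfolding assms(15) exp_weighted.kernel_conv_def[OF exp_weighted_rate] by simp
    then have "(\<lambda>j. of_real (c j) * W j t) sums of_real (w t)"
      unfolding W of_real_mult[symmetric] by (rule sums_of_real)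
    then show "summable (\<lambda>j. of_real (c j) * W j t)" "w t = Re (\<Sum>j. of_real (c j) * W j t)"
      by (auto simp: sums_iff)
  qed
qed

end
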